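(* Let $n\ge2$. The average output length (over uniformly random $X\in pPa_n$) of the planar partition factorization algorithm described in the context is $$\overline L_n^{pPa}=\frac{(2n+1)\left(2^{4n-1}-\binom{4n}{2n}\right)}{\binom{4n}{2n}}.$$ With the step count $T(X)=4n+\bigl(2\cdot 2n+2L(X)\bigr)$, where $L(X)$ is the output length, $4n$ steps are for fattening and $2\cdot2n+2L(X)$ steps are for the Temperley–Lieb factorization in $TL_{2n}$, the average runtime is $$\operatorname{Avg}_n^{pPa}=4n+\frac{2^{4n}(2n+1)}{\binom{4n}{2n}}-2\sim2\sqrt{2\pi}\cdot n^{3/2}\qquad(n\to\infty).$$
   Context: **Planar partition monoid.** $pPa_n$ is the monoid of planar set partitions of the top vertices $1,\dots,n$ and bottom vertices $1',\dots,n'$ (drawn without crossings inside the rectangle), under stacking of diagrams. Generators (all other vertices joined vertically): $p_i$ ($1\le i<n$) has the block $\{i,i+1,i',(i+1)'\}$; $d_i$ ($1\le i\le n$) has singleton blocks $\{i\}$, $\{i'\}$. **Temperley–Lieb algorithm.** $TL_m$ is the monoid of planar perfect matchings of top vertices $1,\dots,m$ and bottom vertices $1',\dots,m'$; $e_i$ has the pairs $\{i,i+1\}$, $\{i',(i+1)'\}$ and all other vertices joined vertically. For $a<b$ let $E(a,b)$ be the list of $e_i$ with $a\le i\le b-1$, $i\equiv a$ mod $2$, and $O(a,b)$ the list of $e_i$ with $a\le i\le b-1$, $i\not\equiv a$ mod $2$, both by increasing $i$. For each top pair $\{a,b\}$, $a<b$ (by increasing $a$) append $O(a,b)$, then $E(a,b)$,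 to a list $F$; for each transversal pair $\{a,c'\}$ with $a<c$ (by increasing $a$) append $E(a,c)$, then $O(a,c)$, to a list top; for each transversal pair $\{a,c'\}$ with $a>c$ (by increasing $a$) append $E(c,a)$, then $O(c,a)$, to a list bot; for each bottom pair $\{a',b'\}$, $a<b$ (by increasing $a$) append $E(a,b)$, then $O(a,b)$, to a list $B$. Reverse $F$ and top and return the concatenation of $F$, top, bot, $B$. (The output length is the sum over all pairs of the absolute difference of the column numbers of the endpoints.) **Planar partition algorithm.** Put $\lambda(i)=2i-1$, $\rho(i)=2i$, $\lambda(i')=(2i)'$, $\rho(i')=(2i-1)'$. Fattening: replace each block of $X\in pPa_n$ with vertices $v_1,\dots,v_m$ listed in clockwise order along the boundary of the rectangle by the pairs $\{\rho(v_j),\lambda(v_{j+1})\}$, $1\le j\le m$, $v_{m+1}=v_1$. This gives $\Phi(X)\in TL_{2n}$. Apply the Temperley–Lieb algorithm to $\Phi(X)$, then replace each $e_j$ by $d_{(j+1)/2}$ if $j$ is odd and by $p_{j/2}$ if $j$ is even. Averages are over the uniform distribution on $pPa_n$. The symbol $\sim$ means asymptotically equal (ratio tends to $1$). *)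

theory Defs
  imports "HOL-Probability.Probability" "HOL-Library.Disjoint_Sets" "HOL-Library.Landau_Symbols"
begin

text \<open>\<open>Top i\<close> is the top vertex \<open>i\<close>, \<open>Bot i\<close> is the bottom vertex \<open>i'\<close>. A diagram is represented by its
  set of blocks.\<close>

datatype vertex = Top nat | Bot nat

definition verts :: "nat \<Rightarrow> vertex set" where
  "verts n = Top ` {1..n} \<union> Bot ` {1..n}"

text \<open>All vertices in clockwise order along the boundary of the rectangle: the top row from left to
  right, then the bottom row from right to left.\<close>

definition boundary :: "nat \<Rightarrow> vertex list" where
  "boundary n = map Top [1..<Suc n] @ map Bot (rev [1..<Suc n])"

text \<open>A diagram can be drawn inside the rectangle without crossings iff no two different blocks
  alternate along the boundary.\<close>

definition planar :: "nat \<Rightarrow> vertex set set \<Rightarrow> bool" where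
  "planar n X \<longleftrightarrow>
    (\<forall>A\<in>X. \<forall>B\<in>X. A \<noteq> B \<longrightarrow>
      \<not> (\<exists>i j k l. i < j \<and> j < k \<and> k < l \<and> l < 2 * n \<and>
            boundary n ! i \<in> A \<and> boundary n ! j \<in> B \<and> boundary n ! k \<in> A \<and> boundary n ! l \<in> B))"

definition pPa :: "nat \<Rightarrow> vertex set set set" where
  "pPa n = {X. partition_on (verts n) X \<and> planar n X}"

definition TL :: "nat \<Rightarrow> vertex set set set" where
  "TL m = {M. partition_on (verts m) M \<and> (\<forall>B\<in>M. card B = 2) \<and> planar m M}"

definition gen_p :: "nat \<Rightarrow> nat \<Rightarrow> vertex set set" where
  "gen_p n i = insert {Top i, Top (i + 1), Bot i, Bot (i + 1)}
     {{Top j, Bot j} | j. j \<in> {1..n} - {i, i + 1}}"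

definition gen_d :: "nat \<Rightarrow> nat \<Rightarrow> vertex set set" where
  "gen_d n i = {{Top i}, {Bot i}} \<union> {{Top j, Bot j} | j. j \<in> {1..n} - {i}}"


subsection \<open>The Temperley--Lieb algorithm\<close>

text \<open>The generator \<open>e\<^sub>i\<close> is represented by its index \<open>i\<close>, so a word in the \<open>e\<^sub>i\<close> is a list of naturals.\<close>

definition run_E :: "nat \<Rightarrow> nat \<Rightarrow> nat list" where
  "run_E a b = filter (\<lambda>i. i mod 2 = a mod 2) [a..<b]"

definition run_O :: "nat \<Rightarrow> nat \<Rightarrow> nat list" where
  "run_O a b = filter (\<lambda>i. i mod 2 \<noteq> a mod 2) [a..<b]"

text \<open>Each of the following enumerates pairs of column numbers by increasing first component \<open>a\<close>; in a
  matching \<open>a\<close> determines the pair.\<close>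

definition top_pairs :: "nat \<Rightarrow> vertex set set \<Rightarrow> (nat \<times> nat) list" where
  "top_pairs m M =
    [(a, b). a \<leftarrow> [1..<Suc m], b \<leftarrow> [1..<Suc m], a < b \<and> {Top a, Top b} \<in> M]"

definition bottom_pairs :: "nat \<Rightarrow> vertex set set \<Rightarrow> (nat \<times> nat) list" where
  "bottom_pairs m M =
    [(a, b). a \<leftarrow> [1..<Suc m], b \<leftarrow> [1..<Suc m], a < b \<and> {Bot a, Bot b} \<in> M]"

definition trans_pairs :: "nat \<Rightarrow> vertex set set \<Rightarrow> (nat \<times> nat) list" where
  "trans_pairs m M =
    [(a, c). a \<leftarrow> [1..<Suc m], c \<leftarrow> [1..<Suc m], {Top a, Bot c} \<in> M]"

definition TL_algorithm :: "nat \<Rightarrow> vertex set set \<Rightarrow> nat list" where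
  "TL_algorithm m M =
    (let F = concat [run_O a b @ run_E a b. (a, b) \<leftarrow> top_pairs m M];
         top = concat [run_E a c @ run_O a c. (a, c) \<leftarrow> trans_pairs m M, a < c];
         bot = concat [run_E c a @ run_O c a. (a, c) \<leftarrow> trans_pairs m M, a > c];
         B = concat [run_E a b @ run_O a b. (a, b) \<leftarrow> bottom_pairs m M]
     in rev F @ rev top @ bot @ B)"


subsection \<open>The planar partition algorithm\<close>

fun lam :: "vertex \<Rightarrow> vertex" where
  "lam (Top i) = Top (2 * i - 1)"
| "lam (Bot i) = Bot (2 * i)"

fun rho :: "vertex \<Rightarrow> vertex" where
  "rho (Top i) = Top (2 * i)"
| "rho (Bot i) = Bot (2 * i - 1)"

definition clockwise :: "nat \<Rightarrow> vertex set \<Rightarrow> vertex list" where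
  "clockwise n B = filter (\<lambda>v. v \<in> B) (boundary n)"

definition fatten :: "nat \<Rightarrow> vertex set set \<Rightarrow> vertex set set" where
  "fatten n X = (\<Union>B\<in>X. let vs = clockwise n B; m = length vs in
     {{rho (vs ! j), lam (vs ! (Suc j mod m))} | j. j < m})"

text \<open>The output is a list of generators of the planar partition monoid, given as diagrams.\<close>

definition pPa_algorithm :: "nat \<Rightarrow> vertex set set \<Rightarrow> vertex set set list" where
  "pPa_algorithm n X =
    map (\<lambda>j. if odd j then gen_d n ((j + 1) div 2) else gen_p n (j div 2))
      (TL_algorithm (2 * n) (fatten n X))"

definition pPa_length :: "nat \<Rightarrow> vertex set set \<Rightarrow> nat" where
  "pPa_length n X = length (pPa_algorithm n X)"

text \<open>Step count: \<open>4 n\<close> steps for fattening, the rest for the Temperley--Lieb factorization of the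
  fattened diagram.\<close>

definition pPa_steps :: "nat \<Rightarrow> vertex set set \<Rightarrow> nat" where
  "pPa_steps n X = 4 * n + (2 * (2 * n) + 2 * pPa_length n X)"

text \<open>\<open>pPa n\<close> is finite and nonempty, so \<open>pmf_of_set\<close> is the uniform distribution on it.\<close>

definition avg_length_pPa :: "nat \<Rightarrow> real" where
  "avg_length_pPa n = measure_pmf.expectation (pmf_of_set (pPa n)) (\<lambda>X. real (pPa_length n X))"

definition avg_runtime_pPa :: "nat \<Rightarrow> real" where
  "avg_runtime_pPa n = measure_pmf.expectation (pmf_of_set (pPa n)) (\<lambda>X. real (pPa_steps n X))"

end

theory Submission
  imports Defs "HOL-Real_Asymp.Real_Asymp"
begin

text \<open>Along the boundary of the rectangle, \<open>pPa n\<close> is the set of noncrossing partitions of \<open>N = 2 n\<close>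
  points on a circle. The output length is the sum, over all vertices \<open>u\<close> with cyclic successor \<open>v\<close> in
  the block of \<open>u\<close>, of the column distance of \<open>rho u\<close> and \<open>lam v\<close>. If \<open>d\<close> points lie strictly between
  \<open>u\<close> and \<open>v\<close>, a partition in which \<open>v\<close> succeeds \<open>u\<close> splits into an arbitrary noncrossing partition of
  these \<open>d\<close> points and, after merging \<open>u\<close> and \<open>v\<close>, one of the remaining \<open>N - 1 - d\<close> points. So there are
  \<open>C\<^sub>d C\<^sub>N\<^sub>-\<^sub>1\<^sub>-\<^sub>d\<close> of them, with \<open>C\<close> the Catalan numbers; summing over \<open>v\<close> gives Segner's recurrence for the
  total number. Summing the distances of all chords with gaps \<open>k\<close> and \<open>N - 1 - k\<close> reduces the
  total length to a convolution of Catalan numbers with a quadratic weight, which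
  Vandermonde's identity for \<open>(1 - 4 x)\<close> to the powers \<open>1/2\<close> and \<open>-1/2\<close> evaluates.\<close>

subsection \<open>Catalan numbers\<close>

text \<open>Real-valued, so that the convolutions below need no divisibility argument.\<close>

definition catalan :: "nat \<Rightarrow> real" where
  "catalan k = real ((2 * k) choose k) / (real k + 1)"

section \<open>Binomial coefficients of exponents 1/2 and -1/2, and Catalan convolutions\<close>

lemma central_binomial_Suc:
  "real ((2 * Suc k) choose Suc k) = 2 * (2 * real k + 1) / (real k + 1) * real ((2 * k) choose k)"
proof -
  have "Suc k * ((2 * Suc k) choose Suc k) = (2 * Suc k) * ((2 * k + 1) choose k)"
    using Suc_times_binomial[of k "2 * k + 1"] by simp
  moreover have "Suc k * ((2 * k + 1) choose k) = (2 * k + 1) * ((2 * k) choose k)"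
    using Suc_times_binomial[of k "2 * k"] Suc_times_binomial_add[of k k]
    by (simp add: mult_2)
  ultimately have "Suc k * ((2 * Suc k) choose Suc k) = 2 * ((2 * k + 1) * ((2 * k) choose k))"
    by (metis mult.assoc)
  then have "(real k + 1) * real ((2 * Suc k) choose Suc k)
      = 2 * ((2 * real k + 1) * real ((2 * k) choose k))"
    by (simp only: of_nat_mult of_nat_Suc of_nat_add of_nat_numeral of_nat_1 add.commute
        flip: of_nat_eq_iff[where 'a = real])
  then show ?thesis by (simp add: field_simps)
qed

text \<open>The coefficients of (1 - 4 x) to the power -1/2 are the central binomial coefficients;
  the factor \<open>(- (1/4)) ^ k\<close> undoes the scaling by -4.\<close>

lemma gbinomial_minus_half: "((- (1/2)) gchoose k) = (- (1/4)) ^ k * real ((2 * k) choose k)"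
proof (induction k)
  case (Suc k)
  have "((- (1/2::real)) gchoose Suc k) = ((- (1/2)) gchoose k) * (-1/2 - real k) / (real k + 1)"
    using gbinomial_mult_1[of "- (1/2::real)" k] by (simp add: field_simps)
  also have "\<dots> = (- (1/4)) ^ Suc k * real ((2 * Suc k) choose Suc k)"
    unfolding Suc.IH central_binomial_Suc by (simp add: field_simps)
  finally show ?case .
qed simp

text \<open>Likewise sqrt (1 - 4 x) is 1 minus twice the sum of all C_k x^(k+1); absorption reduces
  exponent 1/2 to -1/2.\<close>

lemma gbinomial_half: "((1/2) gchoose Suc k) = - 2 * (- (1/4)) ^ Suc k * catalan k"
proof -
  have "real (Suc k) * ((1/2::real) gchoose Suc k) = 1/2 * ((- (1/2)) gchoose k)"
    using gbinomial_absorption[of k "1/2::real"] by simp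
  then show ?thesis
    unfolding gbinomial_minus_half catalan_def by (simp add: field_simps)
qed

text \<open>Exponents -1/2 and -1/2 add up to -1, whose binomial coefficients are just
  signs.\<close>

lemma sum_central_binomial:
  "(\<Sum>k\<le>n. real ((2 * k) choose k) * real ((2 * (n - k)) choose (n - k))) = 4 ^ n"
proof -
  have "(- (1/4)) ^ n * (\<Sum>k\<le>n. real ((2 * k) choose k) * real ((2 * (n - k)) choose (n - k)))
      = (\<Sum>k\<le>n. ((- (1/2)) gchoose k) * ((- (1/2)) gchoose (n - k)))"
    unfolding sum_distrib_left gbinomial_minus_half
    by (intro sum.cong) (auto simp: power_add[symmetric] mult_ac)
  also have "\<dots> = (- (1/2) + (- (1/2))) gchoose n"
    using gbinomial_Vandermonde[of "- (1/2::real)" "- (1/2)" n] by (simp add: atMost_atLeast0)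
  also have "\<dots> = (-1) ^ n"
    using gbinomial_minus[of "1::real" n] by (simp add: binomial_gbinomial[symmetric])
  also have "(-1::real) ^ n = (- (1/4)) ^ n * 4 ^ n"
    by (simp add: power_mult_distrib[symmetric])
  finally show ?thesis by simp
qed

text \<open>Exponents -1/2 and 1/2 add up to 0, so the coefficient of index \<open>Suc n\<close>
  vanishes. Its last term is the central binomial on the right, the others form the
  convolution.\<close>

lemma sum_central_binomial_catalan:
  "(\<Sum>k\<le>n. real ((2 * k) choose k) * catalan (n - k)) = real ((2 * Suc n) choose Suc n) / 2"
proof -
  have "0 = (\<Sum>k\<le>Suc n. ((- (1/2::real)) gchoose k) * ((1/2) gchoose (Suc n - k)))"
    using gbinomial_Vandermonde[of "- (1/2::real)" "1/2" "Suc n"] by (simp add: atMost_atLeast0)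
  also have "\<dots> = (- (1/4)) ^ Suc n * real ((2 * Suc n) choose Suc n)
      + (\<Sum>k\<le>n. ((- (1/2)) gchoose k) * ((1/2) gchoose Suc (n - k)))"
    by (simp add: gbinomial_minus_half Suc_diff_le del: mult_Suc_right binomial_Suc_Suc)
  also have "(\<Sum>k\<le>n. ((- (1/2::real)) gchoose k) * ((1/2) gchoose Suc (n - k)))
      = (- (1/4)) ^ Suc n * (- 2 * (\<Sum>k\<le>n. real ((2 * k) choose k) * catalan (n - k)))"
    unfolding sum_distrib_left gbinomial_minus_half gbinomial_half
    by (intro sum.cong) (auto simp: power_add[symmetric] mult_ac)
  finally have "(- (1/4::real)) ^ Suc n * (real ((2 * Suc n) choose Suc n)
      - 2 * (\<Sum>k\<le>n. real ((2 * k) choose k) * catalan (n - k))) = 0"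
    by (simp only: distrib_left right_diff_distrib)
  then show ?thesis by simp
qed

lemma catalan_0: "catalan 0 = 1"
  by (simp add: catalan_def)

text \<open>Segner's recurrence from exponents 1/2 and 1/2: the coefficient of index
  \<open>n + 2\<close> of 1 - 4 x is 0. The two end terms give \<open>catalan (Suc n)\<close>, the
  inner ones the convolution.\<close>

lemma catalan_Suc: "catalan (Suc n) = (\<Sum>k\<le>n. catalan k * catalan (n - k))"
proof -
  have "(1::real) gchoose Suc (Suc n) = 0"
    using binomial_gbinomial[of 1 "Suc (Suc n)", where 'a = real] by simp
  then have "0 = (\<Sum>k\<le>Suc (Suc n). ((1/2::real) gchoose k) * ((1/2) gchoose (Suc (Suc n) - k)))"
    using gbinomial_Vandermonde[of "1/2::real" "1/2" "Suc (Suc n)"]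
    by (simp add: atMost_atLeast0)
  also have "\<dots> = 2 * ((1/2) gchoose Suc (Suc n))
      + (\<Sum>k\<le>n. ((1/2) gchoose Suc k) * ((1/2) gchoose Suc (n - k)))"
    by (subst sum.atMost_Suc_shift) (simp add: Suc_diff_le)
  also have "(\<Sum>k\<le>n. ((1/2) gchoose Suc k) * ((1/2) gchoose Suc (n - k)))
      = (- (1/4)) ^ Suc (Suc n) * (4 * (\<Sum>k\<le>n. catalan k * catalan (n - k)))"
    unfolding sum_distrib_left gbinomial_half
    by (intro sum.cong) (auto simp: power_add[symmetric] mult_ac)
  finally have "(- (1/4::real)) ^ Suc (Suc n) * (4 * (\<Sum>k\<le>n. catalan k * catalan (n - k))
      - 4 * catalan (Suc n)) = 0"
    unfolding gbinomial_half by (simp add: algebra_simps)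
  then show ?thesis by simp
qed

lemma sum_catalan_weighted:
  assumes "0 < N"
  shows "(\<Sum>k<N. catalan k * catalan (N - 1 - k)
      * (real k * (real N - real k) + (real k + 1) * (real N - 1 - real k)))
    = 2 ^ (2 * N - 1) - real ((2 * N) choose N)"
proof -
  obtain n where N: "N = Suc n" using assms by (cases N) auto
  let ?b = "\<lambda>k. real ((2 * k) choose k)"
  have b: "?b k = (real k + 1) * catalan k" for k
    by (simp add: catalan_def)
  \<comment> \<open>With a = k + 1 and b = N - k the weight is (a - 1) b + a (b - 1) = 2 a b - a -
    b, and the factors a and b turn Catalan numbers into central binomials.\<close>
  have "(\<Sum>k<N. catalan k * catalan (N - 1 - k)
      * (real k * (real N - real k) + (real k + 1) * (real N - 1 - real k)))
    = (\<Sum>k\<le>n. 2 * (?b k * ?b (n - k)) - (?b k * catalan (n - k) + ?b (n - k) * catalan k))"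
    unfolding b N lessThan_Suc_atMost
    by (intro sum.cong) (auto simp: of_nat_diff algebra_simps)
  also have "\<dots> = 2 * (\<Sum>k\<le>n. ?b k * ?b (n - k))
     - ((\<Sum>k\<le>n. ?b k * catalan (n - k)) + (\<Sum>k\<le>n. ?b (n - k) * catalan k))"
    by (simp only: sum_subtractf sum.distrib sum_distrib_left)
  also have "(\<Sum>k\<le>n. ?b (n - k) * catalan k) = (\<Sum>k\<le>n. ?b k * catalan (n - k))"
    by (subst sum.nat_diff_reindex[symmetric, where n = "Suc n", unfolded lessThan_Suc_atMost])
      (auto intro!: sum.cong)
  finally show ?thesis
    unfolding sum_central_binomial sum_central_binomial_catalan N
    by (simp add: power_mult)
qed

lemma central_binomial_asymp_equiv:
  "(\<lambda>n. real ((2 * n) choose n)) \<sim>[at_top] (\<lambda>n. 4 ^ n / sqrt (pi * real n))"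
proof -
  \<comment> \<open>Recasts the quotient in the Gamma-function asymptotics of
    \<open>z gchoose n\<close> at z = -1/2; its limit is 1 / Gamma(1/2) = 1 / sqrt pi.\<close>
  have "eventually (\<lambda>n. ((- (1/2::real)) gchoose n) / ((-1) ^ n / exp ((-1/2 + 1) * of_real (ln (real n))))
      = real ((2 * n) choose n) / (4 ^ n / sqrt (pi * real n)) / sqrt pi) at_top"
    using eventually_gt_at_top[of 0]
  proof eventually_elim
    case (elim n)
    have "exp ((-1/2 + 1) * of_real (ln (real n))) = sqrt (real n)"
      using elim by (simp add: powr_half_sqrt[symmetric] powr_def)
    then show ?case
      using gbinomial_minus_half[of n] power_mult_distrib[of "-1::real" "-1" n]
      by (simp add: power_divide real_sqrt_mult power_minus[of "1/4"] field_simps)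
  qed
  then have "(\<lambda>n. real ((2 * n) choose n) / (4 ^ n / sqrt (pi * real n)) / sqrt pi)
      \<longlonglongrightarrow> inverse (sqrt pi)"
    using gbinomial_asymptotic[of "- (1/2::real)"] Gamma_one_half_real
    by (simp add: filterlim_cong)
  from tendsto_mult_right[OF this, of "sqrt pi"]
  have "(\<lambda>n. real ((2 * n) choose n) / (4 ^ n / sqrt (pi * real n))) \<longlonglongrightarrow> 1"
    by simp
  then show ?thesis
    by (intro asymp_equivI') 
qed


subsection \<open>Noncrossing partitions of points on a circle\<close>

text \<open>Strict cyclic order: false as soon as two of the arguments coincide.\<close>

definition cyc :: "'a::linorder \<Rightarrow> 'a \<Rightarrow> 'a \<Rightarrow> bool" where
  "cyc x y z \<longleftrightarrow> x < y \<and> y < z \<or> y < z \<and> z < x \<or> z < x \<and> x < y"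

definition crossing :: "('a \<Rightarrow> nat) \<Rightarrow> 'a set \<Rightarrow> 'a set \<Rightarrow> bool" where
  "crossing f A B \<longleftrightarrow>
    (\<exists>a\<in>A. \<exists>b\<in>B. \<exists>c\<in>A. \<exists>d\<in>B. cyc (f a) (f b) (f c) \<and> cyc (f c) (f d) (f a))"

text \<open>Positions come from a map \<open>f\<close> on an arbitrary set \<open>S\<close>, so arcs
  and sets with a point removed are again instances and the induction needs no relabelling.\<close>

definition noncrossing_partitions :: "('a \<Rightarrow> nat) \<Rightarrow> 'a set \<Rightarrow> 'a set set set" where
  "noncrossing_partitions f S =
    {X. partition_on S X \<and> (\<forall>A\<in>X. \<forall>B\<in>X. A \<noteq> B \<longrightarrow> \<not> crossing f A B)}"

text \<open>The points strictly between \<open>u\<close> and \<open>v\<close> in cyclic order; stated by excluding the points strictly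
  between \<open>v\<close> and \<open>u\<close>, so that \<open>v = u\<close> gives the full turn \<open>S - {u}\<close>.\<close>

definition cyclic_arc :: "('a \<Rightarrow> nat) \<Rightarrow> 'a set \<Rightarrow> 'a \<Rightarrow> 'a \<Rightarrow> 'a set" where
  "cyclic_arc f S u v = {w \<in> S. w \<noteq> u \<and> w \<noteq> v \<and> \<not> cyc (f v) (f w) (f u)}"

text \<open>The point \<open>v\<close> is the clockwise successor of \<open>u\<close> in its block.
  A singleton block links \<open>u\<close> to itself, since the arc from \<open>u\<close> to
  \<open>u\<close> is the full turn.\<close>

definition linked :: "('a \<Rightarrow> nat) \<Rightarrow> 'a set \<Rightarrow> 'a set set \<Rightarrow> 'a \<Rightarrow> 'a \<Rightarrow> bool" where
  "linked f S X u v \<longleftrightarrow> (\<exists>B\<in>X. u \<in> B \<and> v \<in> B \<and> B \<inter> cyclic_arc f S u v = {})"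

lemma cyc_cases:
  assumes "x \<noteq> y" "y \<noteq> z" "z \<noteq> (x::'a::linorder)"
  obtains "cyc x y z" | "cyc z y x"
  using assms unfolding cyc_def by (metis linorder_neqE)

lemma crossing_sym: "crossing f A B \<Longrightarrow> crossing f B A"
  unfolding crossing_def
proof (elim bexE conjE)
  fix a b c d
  assume "a \<in> A" "b \<in> B" "c \<in> A" "d \<in> B" "cyc (f a) (f b) (f c)" "cyc (f c) (f d) (f a)"
  moreover from this have "cyc (f b) (f c) (f d)" "cyc (f d) (f a) (f b)"
    unfolding cyc_def by linarith+
  ultimately show "\<exists>a\<in>B. \<exists>b\<in>A. \<exists>c\<in>B. \<exists>d\<in>A. cyc (f a) (f b) (f c) \<and> cyc (f c) (f d) (f a)"
    by blast
qed

lemma crossing_mono: "crossing f A B \<Longrightarrow> A \<subseteq> A' \<Longrightarrow> B \<subseteq> B' \<Longrightarrow> crossing f A' B'"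
  unfolding crossing_def by blast

text \<open>If \<open>a\<close> and \<open>c\<close> lie in the open arc from \<open>u\<close> to
  \<open>v\<close>, one of the two ways around between them stays inside that arc, so it meets
  neither \<open>b\<close> nor \<open>d\<close>.\<close>

lemma not_separated_arc:
  assumes "\<not> cyc v a u" "\<not> cyc v c u" "a \<noteq> u" "a \<noteq> v" "c \<noteq> u" "c \<noteq> v"
    and "b = u \<or> b = v \<or> cyc v b u" "d = u \<or> d = v \<or> cyc v d u"
    and "cyc a b c" "cyc c d (a::nat)"
  shows False
  using assms unfolding cyc_def by (smt (verit) order.asym order.strict_trans linorder_neqE)

lemma not_crossing_arc:
  assumes inj: "inj_on f S" and uv: "u \<in> S" "v \<in> S"
    and A: "A \<subseteq> cyclic_arc f S u v" and B: "B \<subseteq> S - cyclic_arc f S u v"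
  shows "\<not> crossing f A B"
proof
  assume "crossing f A B"
  then obtain a b c d where *: "a \<in> A" "b \<in> B" "c \<in> A" "d \<in> B"
    "cyc (f a) (f b) (f c)" "cyc (f c) (f d) (f a)"
    unfolding crossing_def by blast
  have "x \<in> S" "f x \<noteq> f u" "f x \<noteq> f v" "\<not> cyc (f v) (f x) (f u)" if "x \<in> A" for x
    using that A inj uv unfolding cyclic_arc_def inj_on_def by blast+
  moreover have "f x = f u \<or> f x = f v \<or> cyc (f v) (f x) (f u)" if "x \<in> B" for x
    using that B unfolding cyclic_arc_def by blast
  ultimately show False
    using * not_separated_arc[of "f v" "f a" "f u" "f c" "f b" "f d"] by simp
qed

section \<open>Splitting a noncrossing partition along an arc and merging the end points\<close>

lemma partition_on_Un:
  "partition_on A X \<Longrightarrow> partition_on B Y \<Longrightarrow> A \<inter> B = {} \<Longrightarrow> partition_on (A \<union> B) (X \<union> Y)"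
  unfolding partition_on_def by (auto intro!: disjoint_union)

lemma finite_noncrossing_partitions: "finite S \<Longrightarrow> finite (noncrossing_partitions f S)"
  by (rule finite_subset[of _ "Pow (Pow S)"])
    (auto simp: noncrossing_partitions_def partition_on_def)

lemma noncrossing_partitions_empty: "noncrossing_partitions f {} = {{}}"
  by (auto simp: noncrossing_partitions_def partition_on_def)

text \<open>A block with points d inside and e outside the arc is not the block of \<open>u\<close>
  and \<open>v\<close>, and u, d, v, e alternate, so these two blocks would cross.\<close>

lemma linked_block_sides:
  assumes inj: "inj_on f S" and uv: "u \<in> S" "v \<in> S"
    and X: "X \<in> noncrossing_partitions f S" and l: "linked f S X u v" and D: "D \<in> X"
  shows "D \<subseteq> cyclic_arc f S u v \<or> D \<subseteq> S - cyclic_arc f S u v"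
proof (rule ccontr)
  assume neg: "\<not> ?thesis"
  have DS: "D \<subseteq> S" using X D by (auto simp: noncrossing_partitions_def partition_on_def)
  obtain B where B: "B \<in> X" "u \<in> B" "v \<in> B" "B \<inter> cyclic_arc f S u v = {}"
    using l unfolding linked_def by blast
  have BS: "B \<subseteq> S" using X B by (auto simp: noncrossing_partitions_def partition_on_def)
  have "B \<noteq> D" using neg B BS by blast
  then have disj: "B \<inter> D = {}"
    using X B D by (auto simp: noncrossing_partitions_def partition_on_def disjoint_def)
  obtain d e where d: "d \<in> D" "d \<in> cyclic_arc f S u v" and e: "e \<in> D" "e \<notin> cyclic_arc f S u v"
    using neg DS by blast
  have "e \<noteq> u" "e \<noteq> v" using disj e B by auto
  then have ce: "cyc (f v) (f e) (f u)" using e DS unfolding cyclic_arc_def by blast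
  then have "f u \<noteq> f v" by (auto simp: cyc_def)
  have "d \<noteq> u" "d \<noteq> v" "\<not> cyc (f v) (f d) (f u)" "d \<in> S" using d unfolding cyclic_arc_def by auto
  moreover from this have "f d \<noteq> f u" "f d \<noteq> f v" using inj uv by (auto simp: inj_on_def)
  ultimately have "cyc (f u) (f d) (f v)" using \<open>f u \<noteq> f v\<close> cyc_cases by metis
  then have "crossing f B D" using ce B d e unfolding crossing_def by blast
  then show False using X B D \<open>B \<noteq> D\<close> by (auto simp: noncrossing_partitions_def)
qed

text \<open>Every block lies on one side by \<open>linked_block_sides\<close>, and blocks from
  different sides never cross by \<open>not_crossing_arc\<close>; hence union and restriction are
  mutually inverse.\<close>

lemma bij_betw_split_arc:
  assumes inj: "inj_on f S" and uv: "u \<in> S" "v \<in> S"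
  defines "T \<equiv> cyclic_arc f S u v"
  shows "bij_betw (\<lambda>(X, Y). X \<union> Y)
     (noncrossing_partitions f T \<times>
       {Y \<in> noncrossing_partitions f (S - T). \<exists>B\<in>Y. u \<in> B \<and> v \<in> B})
     {X \<in> noncrossing_partitions f S. linked f S X u v}"
proof (rule bij_betw_byWitness[where f' = "\<lambda>X. ({B \<in> X. B \<subseteq> T}, {B \<in> X. B \<subseteq> S - T})"])
  have TS: "T \<subseteq> S" unfolding T_def cyclic_arc_def by blast
  show "\<forall>a\<in>noncrossing_partitions f T \<times>
       {Y \<in> noncrossing_partitions f (S - T). \<exists>B\<in>Y. u \<in> B \<and> v \<in> B}.
     ({B \<in> case a of (X, Y) \<Rightarrow> X \<union> Y. B \<subseteq> T}, {B \<in> case a of (X, Y) \<Rightarrow> X \<union> Y. B \<subseteq> S - T}) = a"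
  proof
    fix p assume "p \<in> noncrossing_partitions f T \<times>
       {Y \<in> noncrossing_partitions f (S - T). \<exists>B\<in>Y. u \<in> B \<and> v \<in> B}"
    then obtain X Y where p: "p = (X, Y)"
      and "X \<in> noncrossing_partitions f T" "Y \<in> noncrossing_partitions f (S - T)" by blast
    then have "\<Union>X = T" "\<Union>Y = S - T" "{} \<notin> X" "{} \<notin> Y"
      by (auto simp: noncrossing_partitions_def partition_on_def)
    then have "\<And>B. B \<in> X \<Longrightarrow> B \<subseteq> T \<and> B \<noteq> {}" "\<And>B. B \<in> Y \<Longrightarrow> B \<subseteq> S - T \<and> B \<noteq> {}"
      by blast+
    then have "{B \<in> X \<union> Y. B \<subseteq> T} = X" "{B \<in> X \<union> Y. B \<subseteq> S - T} = Y"
      by blast+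
    then show "({B \<in> case p of (X, Y) \<Rightarrow> X \<union> Y. B \<subseteq> T},
        {B \<in> case p of (X, Y) \<Rightarrow> X \<union> Y. B \<subseteq> S - T}) = p"
      unfolding p by simp
  qed
  show "\<forall>X\<in>{X \<in> noncrossing_partitions f S. linked f S X u v}.
      (case ({B \<in> X. B \<subseteq> T}, {B \<in> X. B \<subseteq> S - T}) of (X, Y) \<Rightarrow> X \<union> Y) = X"
    using linked_block_sides[OF inj uv] unfolding T_def by auto
  show "(\<lambda>(X, Y). X \<union> Y) ` (noncrossing_partitions f T \<times>
       {Y \<in> noncrossing_partitions f (S - T). \<exists>B\<in>Y. u \<in> B \<and> v \<in> B})
     \<subseteq> {X \<in> noncrossing_partitions f S. linked f S X u v}"
  proof clarify
    fix X Y B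
    assume X: "X \<in> noncrossing_partitions f T"
      and Y: "Y \<in> noncrossing_partitions f (S - T)" and B: "B \<in> Y" "u \<in> B" "v \<in> B"
    have XT: "A \<subseteq> T" if "A \<in> X" for A
      using X that by (auto simp: noncrossing_partitions_def partition_on_def)
    have YT: "A \<subseteq> S - T" if "A \<in> Y" for A
      using Y that by (auto simp: noncrossing_partitions_def partition_on_def)
    have "partition_on (T \<union> (S - T)) (X \<union> Y)"
      using X Y by (intro partition_on_Un) (auto simp: noncrossing_partitions_def)
    then have "partition_on S (X \<union> Y)" using TS by (simp add: Un_absorb1)
    moreover have "\<not> crossing f A C" if AC: "A \<in> X \<union> Y" "C \<in> X \<union> Y" "A \<noteq> C" for A C
    proof -
      have mixed: "\<not> crossing f P Q" if "P \<in> X" "Q \<in> Y" for P Q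
        using not_crossing_arc[OF inj uv] XT[OF that(1)] YT[OF that(2)] unfolding T_def by blast
      from AC(1,2) consider "A \<in> X" "C \<in> X" | "A \<in> Y" "C \<in> Y" | "A \<in> X" "C \<in> Y" | "A \<in> Y" "C \<in> X"
        by blast
      then show ?thesis
      proof cases
        case 1
        then show ?thesis using X AC(3) by (simp add: noncrossing_partitions_def)
      next
        case 2
        then show ?thesis using Y AC(3) by (simp add: noncrossing_partitions_def)
      next
        case 3
        then show ?thesis by (rule mixed)
      next
        case 4
        then show ?thesis using mixed crossing_sym by blast
      qed
    qed
    moreover have "linked f S (X \<union> Y) u v"
      using B YT[OF B(1)] unfolding linked_def T_def by blast
    ultimately show "X \<union> Y \<in> noncrossing_partitions f S \<and> linked f S (X \<union> Y) u v"
      by (auto simp: noncrossing_partitions_def)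
  qed
  show "(\<lambda>X. ({B \<in> X. B \<subseteq> T}, {B \<in> X. B \<subseteq> S - T})) `
      {X \<in> noncrossing_partitions f S. linked f S X u v}
     \<subseteq> noncrossing_partitions f T \<times>
       {Y \<in> noncrossing_partitions f (S - T). \<exists>B\<in>Y. u \<in> B \<and> v \<in> B}"
  proof clarify
    fix X
    assume X: "X \<in> noncrossing_partitions f S" and l: "linked f S X u v"
    have sides: "D \<subseteq> T \<or> D \<subseteq> S - T" if "D \<in> X" for D
      using linked_block_sides[OF inj uv X l that] unfolding T_def .
    have p: "\<Union>X = S" "disjoint X" "{} \<notin> X"
      using X by (auto simp: noncrossing_partitions_def partition_on_def)
    have sub: "partition_on R {B \<in> X. B \<subseteq> R}"
      if "R \<subseteq> S" "\<And>D. D \<in> X \<Longrightarrow> D \<subseteq> R \<or> D \<inter> R = {}" for R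
    proof (rule partition_onI)
      show "\<Union>{B \<in> X. B \<subseteq> R} = R"
      proof
        show "R \<subseteq> \<Union>{B \<in> X. B \<subseteq> R}"
        proof
          fix x assume x: "x \<in> R"
          then obtain D where "D \<in> X" "x \<in> D" using \<open>R \<subseteq> S\<close> p(1) by blast
          then show "x \<in> \<Union>{B \<in> X. B \<subseteq> R}" using that(2)[of D] x by blast
        qed
      qed blast
      show "disjnt P Q" if "P \<in> {B \<in> X. B \<subseteq> R}" "Q \<in> {B \<in> X. B \<subseteq> R}" "P \<noteq> Q" for P Q
        using p(2) that by (simp add: pairwise_def)
    qed (use p(3) in simp)
    have "{B \<in> X. B \<subseteq> T} \<in> noncrossing_partitions f T"
      using X sub[OF TS] sides unfolding noncrossing_partitions_def by fast
    moreover have "{B \<in> X. B \<subseteq> S - T} \<in> noncrossing_partitions f (S - T)"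
      using X sub[of "S - T"] sides unfolding noncrossing_partitions_def by fast
    moreover have "\<exists>B\<in>{B \<in> X. B \<subseteq> S - T}. u \<in> B \<and> v \<in> B"
      using l p unfolding linked_def T_def by fastforce
    ultimately show "{B \<in> X. B \<subseteq> T} \<in> noncrossing_partitions f T \<and>
        {B \<in> X. B \<subseteq> S - T} \<in> {Y \<in> noncrossing_partitions f (S - T). \<exists>B\<in>Y. u \<in> B \<and> v \<in> B}"
      by blast
  qed
qed

text \<open>No point of \<open>R\<close> lies between \<open>u\<close> and \<open>v\<close>, so
  wherever \<open>v\<close> takes part in an alternation, \<open>u\<close> can replace it.\<close>

lemma crossing_insert_adjacent:
  assumes inj: "inj_on f R" and uv: "u \<in> R" "v \<in> R" "u \<noteq> v" and adj: "cyclic_arc f R u v = {}"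
    and A: "A \<subseteq> R - {v}" and B: "B \<subseteq> R - {v}" and "A \<inter> B = {}" and "u \<in> A"
    and cr: "crossing f (insert v A) B"
  shows "crossing f A B"
proof -
  have between: "cyc (f v) (f x) (f u)" if "x \<in> R" "x \<noteq> u" "x \<noteq> v" for x
    using adj that unfolding cyclic_arc_def by blast
  obtain a b c d where *: "a \<in> insert v A" "b \<in> B" "c \<in> insert v A" "d \<in> B"
    "cyc (f a) (f b) (f c)" "cyc (f c) (f d) (f a)"
    using cr unfolding crossing_def by blast
  have in_B: "x \<in> R \<and> x \<noteq> u \<and> x \<noteq> v \<and> f x \<noteq> f u \<and> f x \<noteq> f v \<and> cyc (f v) (f x) (f u)"
    if "x \<in> B" for x
    using that B \<open>A \<inter> B = {}\<close> \<open>u \<in> A\<close> between inj uv unfolding inj_on_def by blast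
  have in_A: "x = u \<or> f x \<noteq> f u \<and> f x \<noteq> f v \<and> cyc (f v) (f x) (f u)" if "x \<in> A" for x
    using that A between inj uv unfolding inj_on_def by blast
  have ne: "f u \<noteq> f v" using inj uv by (auto simp: inj_on_def)
  define r where "r x = (if x = v then u else x)" for x
  have r: "r a \<in> A" "r c \<in> A" using * \<open>u \<in> A\<close> by (auto simp: r_def)
  \<comment> \<open>The replacement cannot identify \<open>a\<close> with \<open>c\<close>: if they
    were \<open>u\<close> and \<open>v\<close>, then \<open>b\<close> or \<open>d\<close> would lie
    between \<open>u\<close> and \<open>v\<close>.\<close>
  have "cyc (f (r a)) (f b) (f (r c)) \<and> cyc (f (r c)) (f d) (f (r a))"
    using * in_B[OF *(2)] in_B[OF *(4)] in_A[of a] in_A[of c] ne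
    unfolding r_def cyc_def by (smt (verit) insertE linorder_neqE_nat order.asym order.strict_trans)
  then show ?thesis using r * unfolding crossing_def by blast
qed

text \<open>Deleting \<open>v\<close> leaves its block nonempty because \<open>u\<close> stays;
  adding \<open>v\<close> to the block of \<open>u\<close> creates no crossing by
  \<open>crossing_insert_adjacent\<close>.\<close>

lemma bij_betw_merge_adjacent:
  assumes inj: "inj_on f R" and uv: "u \<in> R" "v \<in> R" "u \<noteq> v" and adj: "cyclic_arc f R u v = {}"
  shows "bij_betw ((`) (\<lambda>B. if u \<in> B then insert v B else B))
     (noncrossing_partitions f (R - {v}))
     {Y \<in> noncrossing_partitions f R. \<exists>B\<in>Y. u \<in> B \<and> v \<in> B}"
    (is "bij_betw ((`) ?ins) _ _")
proof (rule bij_betw_byWitness[where f' = "(`) (\<lambda>B. B - {v})"])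
  show "\<forall>Z\<in>noncrossing_partitions f (R - {v}). (\<lambda>B. B - {v}) ` ?ins ` Z = Z"
  proof
    fix Z assume "Z \<in> noncrossing_partitions f (R - {v})"
    then have "v \<notin> B" if "B \<in> Z" for B
      using that by (auto simp: noncrossing_partitions_def partition_on_def)
    then have "?ins B - {v} = B" if "B \<in> Z" for B using that by auto
    then have "(\<lambda>B. ?ins B - {v}) ` Z = (\<lambda>B. B) ` Z" by (rule image_cong[OF refl])
    then show "(\<lambda>B. B - {v}) ` ?ins ` Z = Z" by (simp only: image_image image_ident)
  qed
  show "\<forall>Y\<in>{Y \<in> noncrossing_partitions f R. \<exists>B\<in>Y. u \<in> B \<and> v \<in> B}.
      ?ins ` (\<lambda>B. B - {v}) ` Y = Y"
  proof clarify
    fix Y B assume Y: "Y \<in> noncrossing_partitions f R" and B: "B \<in> Y" "u \<in> B" "v \<in> B"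
    then have "D = B \<or> u \<notin> D \<and> v \<notin> D" if "D \<in> Y" for D
      using that by (auto simp: noncrossing_partitions_def partition_on_def disjoint_def)
    then have "?ins (D - {v}) = D" if "D \<in> Y" for D using that B uv by auto
    then have "(\<lambda>D. ?ins (D - {v})) ` Y = (\<lambda>D. D) ` Y" by (rule image_cong[OF refl])
    then show "?ins ` (\<lambda>B. B - {v}) ` Y = Y" by (simp only: image_image image_ident)
  qed
  show "(`) ?ins ` noncrossing_partitions f (R - {v})
     \<subseteq> {Y \<in> noncrossing_partitions f R. \<exists>B\<in>Y. u \<in> B \<and> v \<in> B}"
  proof clarify
    fix Z assume "Z \<in> noncrossing_partitions f (R - {v})"
    then have Z: "partition_on (R - {v}) Z"
      and nc: "\<And>A B. A \<in> Z \<Longrightarrow> B \<in> Z \<Longrightarrow> A \<noteq> B \<Longrightarrow> \<not> crossing f A B"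
      by (auto simp: noncrossing_partitions_def)
    have sub: "D \<subseteq> R - {v}" if "D \<in> Z" for D using Z that by (auto simp: partition_on_def)
    have dis: "A \<inter> B = {}" if "A \<in> Z" "B \<in> Z" "A \<noteq> B" for A B
      using Z that by (auto simp: partition_on_def disjoint_def)
    obtain U where U: "U \<in> Z" "u \<in> U" using Z uv by (auto simp: partition_on_def)
    have ins: "?ins D = (if D = U then insert v U else D)" if "D \<in> Z" for D
      using U dis[OF that U(1)] by auto
    have "\<Union>(?ins ` Z) = R"
      using Z U uv unfolding partition_on_def by (auto split: if_splits)
    moreover have "{} \<notin> ?ins ` Z"
      using Z by (auto simp: partition_on_def split: if_splits)
    moreover have "disjoint (?ins ` Z)"
      unfolding disjoint_def using sub dis ins by (auto split: if_splits)
    moreover have "\<not> crossing f A B" if "A \<in> ?ins ` Z" "B \<in> ?ins ` Z" "A \<noteq> B" for A B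
    proof -
      obtain A' B' where AB: "A' \<in> Z" "B' \<in> Z" "A = ?ins A'" "B = ?ins B'" using \<open>A \<in> ?ins ` Z\<close> \<open>B \<in> ?ins ` Z\<close> by blast
      then have "A' \<noteq> B'" using \<open>A \<noteq> B\<close> by auto
      have *: "\<not> crossing f (insert v U) D" if "D \<in> Z" "D \<noteq> U" for D
        using crossing_insert_adjacent[OF inj uv adj sub[OF U(1)] sub[OF that(1)] dis[OF U(1) that(1)] U(2)]
          nc[OF U(1) that(1)] that(2) by blast
      show ?thesis
        using AB(3,4) ins[OF AB(1)] ins[OF AB(2)] * nc[OF AB(1,2)] AB(1,2) \<open>A' \<noteq> B'\<close> crossing_sym
        by metis
    qed
    moreover have "\<exists>B\<in>?ins ` Z. u \<in> B \<and> v \<in> B"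
      by (rule bexI[of _ "?ins U"]) (use U in simp_all)
    ultimately show "?ins ` Z \<in> noncrossing_partitions f R \<and> (\<exists>B\<in>?ins ` Z. u \<in> B \<and> v \<in> B)"
      unfolding noncrossing_partitions_def partition_on_def by blast
  qed
  show "(`) (\<lambda>B. B - {v}) ` {Y \<in> noncrossing_partitions f R. \<exists>B\<in>Y. u \<in> B \<and> v \<in> B}
     \<subseteq> noncrossing_partitions f (R - {v})"
  proof clarify
    fix Y B assume "Y \<in> noncrossing_partitions f R" and B: "B \<in> Y" "u \<in> B" "v \<in> B"
    then have Y: "\<Union>Y = R" "disjoint Y" "{} \<notin> Y"
      and nc: "\<And>A B. A \<in> Y \<Longrightarrow> B \<in> Y \<Longrightarrow> A \<noteq> B \<Longrightarrow> \<not> crossing f A B"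
      by (auto simp: noncrossing_partitions_def partition_on_def)
    have v: "v \<notin> D" if "D \<in> Y" "D \<noteq> B" for D
      using Y B that by (auto simp: disjoint_def)
    have "D - {v} \<noteq> {}" if "D \<in> Y" for D
      using v[OF that] that Y B uv by (cases "D = B") auto
    then have "partition_on (R - {v}) ((\<lambda>B. B - {v}) ` Y)"
      using Y unfolding partition_on_def disjoint_def by (auto; blast)
    moreover have "\<not> crossing f (A - {v}) (D - {v})" if "A \<in> Y" "D \<in> Y" "A \<noteq> D" for A D
      using nc[OF that] crossing_mono[of f "A - {v}" "D - {v}" A D] by blast
    ultimately show "(\<lambda>B. B - {v}) ` Y \<in> noncrossing_partitions f (R - {v})"
      by (auto simp: noncrossing_partitions_def)
  qed
qed

lemma card_linked_split:
  assumes fin: "finite S" and inj: "inj_on f S" and uv: "u \<in> S" "v \<in> S"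
  shows "card {X \<in> noncrossing_partitions f S. linked f S X u v} =
    card (noncrossing_partitions f (cyclic_arc f S u v)) *
    card (noncrossing_partitions f (S - cyclic_arc f S u v - {v}))"
proof -
  define T where "T = cyclic_arc f S u v"
  have uT: "u \<in> S - T" "v \<in> S - T" using uv by (auto simp: T_def cyclic_arc_def)
  have "card {Y \<in> noncrossing_partitions f (S - T). \<exists>B\<in>Y. u \<in> B \<and> v \<in> B}
      = card (noncrossing_partitions f (S - T - {v}))"
  \<comment> \<open>Merging requires two different points. For \<open>u = v\<close> the arc is all
    of \<open>S - {v}\<close>, and both counts equal 1: the partitions \<open>{{v}}\<close> of the
    point and \<open>{}\<close> of the empty set.\<close>
  proof (cases "u = v")
    case True
    have "S - T = {v}" using True uv by (auto simp: T_def cyclic_arc_def cyc_def)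
    moreover have "partition_on {v} Y \<longleftrightarrow> Y = {{v}}" for Y
    proof
      assume "partition_on {v} Y"
      then have Y: "\<Union>Y = {v}" "{} \<notin> Y" by (auto simp: partition_on_def)
      then have "B = {v}" if "B \<in> Y" for B using that by (metis Union_upper subset_singletonD)
      moreover have "Y \<noteq> {}" using Y by auto
      ultimately show "Y = {{v}}" by blast
    qed (simp add: partition_on_space)
    ultimately have "{Y \<in> noncrossing_partitions f (S - T). \<exists>B\<in>Y. u \<in> B \<and> v \<in> B} = {{{v}}}"
      using True by (auto simp: noncrossing_partitions_def)
    then show ?thesis using \<open>S - T = {v}\<close> by (simp add: noncrossing_partitions_empty)
  next
    case False
    have "cyclic_arc f (S - T) u v = {}" by (auto simp: T_def cyclic_arc_def)
    from bij_betw_merge_adjacent[OF inj_on_subset[OF inj] uT False this]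
    show ?thesis by (auto dest: bij_betw_same_card)
  qed
  then show ?thesis
    using bij_betw_same_card[OF bij_betw_split_arc[OF inj uv]]
    unfolding T_def by (simp add: card_cartesian_product)
qed

section \<open>The cyclic successor of a point in its block\<close>

lemma arc_subset: "cyclic_arc f S u v \<subseteq> S - {v}"
  unfolding cyclic_arc_def by blast

text \<open>With \<open>arc_total\<close>, the arcs from a fixed \<open>u\<close> form a chain under
  inclusion, in the order in which a clockwise tour from \<open>u\<close> meets their end points,
  with \<open>u\<close> itself last.\<close>

lemma arc_psubset:
  assumes inj: "inj_on f S" and "u \<in> S" "v \<in> S" "w \<in> cyclic_arc f S u v"
  shows "cyclic_arc f S u w \<subset> cyclic_arc f S u v"
proof -
  have w: "w \<in> S" "w \<noteq> u" "w \<noteq> v" "\<not> cyc (f v) (f w) (f u)" using assms by (auto simp: cyclic_arc_def)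
  have "x \<in> cyclic_arc f S u v" if "x \<in> cyclic_arc f S u w" for x
  proof -
    have x: "x \<in> S" "x \<noteq> u" "x \<noteq> w" "\<not> cyc (f w) (f x) (f u)" using that by (auto simp: cyclic_arc_def)
    have ne: "f w \<noteq> f u" "f w \<noteq> f v" "f x \<noteq> f u" "f x \<noteq> f w" "v \<noteq> u \<longrightarrow> f v \<noteq> f u" "f x = f v \<longleftrightarrow> x = v"
      using inj x w assms by (auto simp: inj_on_def)
    have "x \<noteq> v" "\<not> cyc (f v) (f x) (f u)"
      using ne x(4) w unfolding cyc_def by (smt (verit) linorder_neqE_nat order.strict_trans)+
    then show ?thesis using x by (auto simp: cyclic_arc_def)
  qed
  moreover have "w \<notin> cyclic_arc f S u w" by (simp add: cyclic_arc_def)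
  ultimately show ?thesis using assms by blast
qed

lemma arc_total:
  assumes inj: "inj_on f S" and "u \<in> S" "v \<in> S" "w \<in> S" "v \<noteq> w"
  shows "v \<in> cyclic_arc f S u w \<or> w \<in> cyclic_arc f S u v"
proof (rule ccontr)
  assume neg: "\<not> ?thesis"
  have "f v \<noteq> f w" "v \<noteq> u \<longrightarrow> f v \<noteq> f u" "w \<noteq> u \<longrightarrow> f w \<noteq> f u" using assms by (auto simp: inj_on_def)
  moreover have "v = u \<or> cyc (f w) (f v) (f u)" "w = u \<or> cyc (f v) (f w) (f u)"
    using neg assms by (auto simp: cyclic_arc_def)
  ultimately show False using \<open>v \<noteq> w\<close> unfolding cyc_def by (smt (verit) order.strict_trans order.asym)
qed

text \<open>Of two different successors, one would lie in the arc to the other, which is free of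
  points of the block.\<close>

lemma linked_unique:
  assumes inj: "inj_on f S" and "partition_on S X" and l: "linked f S X u v" "linked f S X u w"
  shows "v = w"
proof (rule ccontr)
  assume "v \<noteq> w"
  obtain B C where "B \<in> X" "u \<in> B" "v \<in> B" "B \<inter> cyclic_arc f S u v = {}"
    "C \<in> X" "u \<in> C" "w \<in> C" "C \<inter> cyclic_arc f S u w = {}"
    using l unfolding linked_def by blast
  moreover from this have "B = C"
    using partition_onD2[OF assms(2)] by (meson disjnt_iff pairwiseD)
  moreover from calculation have "u \<in> S" "v \<in> S" "w \<in> S" using assms by (auto simp: partition_on_def)
  ultimately show False using arc_total[OF inj, of u v w] \<open>v \<noteq> w\<close> by blast
qed

lemma linked_exists:
  assumes "finite S" and inj: "inj_on f S" and X: "partition_on S X" and u: "u \<in> S"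
  shows "\<exists>v\<in>S. linked f S X u v"
proof -
  obtain B where B: "B \<in> X" "u \<in> B" using X u by (auto simp: partition_on_def)
  then have BS: "B \<subseteq> S" using X by (auto simp: partition_on_def)
  \<comment> \<open>The successor is the point of the block with the smallest arc; \<open>u\<close>
    itself is a candidate, which covers singleton blocks.\<close>
  obtain v where v: "v \<in> B" and min: "\<And>w. w \<in> B \<Longrightarrow> card (cyclic_arc f S u v) \<le> card (cyclic_arc f S u w)"
    using ex_has_least_nat[of "\<lambda>v. v \<in> B" u "\<lambda>v. card (cyclic_arc f S u v)"] B by blast
  have "B \<inter> cyclic_arc f S u v = {}"
  proof (rule ccontr)
    assume "B \<inter> cyclic_arc f S u v \<noteq> {}"
    then obtain w where w: "w \<in> B" "w \<in> cyclic_arc f S u v" by blast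
    have "finite (cyclic_arc f S u v)" using arc_subset \<open>finite S\<close> by (meson finite_Diff finite_subset)
    then have "card (cyclic_arc f S u w) < card (cyclic_arc f S u v)"
      using arc_psubset[OF inj u _ w(2)] v BS by (auto intro: psubset_card_mono)
    then show False using min[OF w(1)] by simp
  qed
  then show ?thesis using B v BS unfolding linked_def by blast
qed

lemma card_arc_less:
  assumes "finite S" "v \<in> S"
  shows "card (cyclic_arc f S u v) < card S"
  using assms arc_subset[of f S u v] by (intro psubset_card_mono) auto

text \<open>Sizes strictly increase along the chain of arcs and stay below \<open>card S\<close>, so
  each value occurs once. This turns sums over successors into Catalan convolutions.\<close>

lemma bij_betw_card_arc:
  assumes "finite S" and inj: "inj_on f S" and u: "u \<in> S"
  shows "bij_betw (\<lambda>v. card (cyclic_arc f S u v)) S {..<card S}"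
proof -
  have "finite (cyclic_arc f S u v)" for v
    using arc_subset \<open>finite S\<close> by (meson finite_Diff finite_subset)
  then have less: "card (cyclic_arc f S u w) < card (cyclic_arc f S u v)" if "v \<in> S" "w \<in> cyclic_arc f S u v" for v w
    using arc_psubset[OF inj u that] by (auto intro: psubset_card_mono)
  have i: "inj_on (\<lambda>v. card (cyclic_arc f S u v)) S"
    using less arc_total[OF inj u] unfolding inj_on_def by (metis less_irrefl)
  moreover have "(\<lambda>v. card (cyclic_arc f S u v)) ` S \<subseteq> {..<card S}"
    using card_arc_less[OF \<open>finite S\<close>] by auto
  ultimately show ?thesis
    unfolding bij_betw_def by (simp add: card_image card_subset_eq)
qed

section \<open>Counting noncrossing partitions by the successor of a point\<close>

lemma card_eq_sum_linked:
  assumes "finite S" and inj: "inj_on f S" and u: "u \<in> S"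
  shows "card (noncrossing_partitions f S) =
    (\<Sum>v\<in>S. card {X \<in> noncrossing_partitions f S. linked f S X u v})"
proof -
  have "noncrossing_partitions f S = (\<Union>v\<in>S. {X \<in> noncrossing_partitions f S. linked f S X u v})"
    using linked_exists[OF \<open>finite S\<close> inj _ u] by (auto simp: noncrossing_partitions_def)
  also have "card \<dots> = (\<Sum>v\<in>S. card {X \<in> noncrossing_partitions f S. linked f S X u v})"
  proof (intro card_UN_disjoint ballI impI)
    show "finite {X \<in> noncrossing_partitions f S. linked f S X u v}" for v
      using finite_noncrossing_partitions[OF \<open>finite S\<close>, of f] by simp
    show "{X \<in> noncrossing_partitions f S. linked f S X u v} \<inter>
        {X \<in> noncrossing_partitions f S. linked f S X u w} = {}" if "v \<noteq> w" for v w
      using linked_unique[OF inj] that by (auto simp: noncrossing_partitions_def)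
  qed fact
  finally show ?thesis .
qed

text \<open>Strong induction on the size: for each successor of a fixed point both factors of
  \<open>card_linked_split\<close> live on smaller sets, and the sum over successors is Segner's
  recurrence.\<close>

theorem card_noncrossing_partitions:
  "finite S \<Longrightarrow> inj_on f S \<Longrightarrow> real (card (noncrossing_partitions f S)) = catalan (card S)"
proof (induction "card S" arbitrary: S rule: less_induct)
  case less
  show ?case
  proof (cases "S = {}")
    case True
    then show ?thesis by (simp add: noncrossing_partitions_empty catalan_0)
  next
    case False
    then obtain u n where u: "u \<in> S" and n: "card S = Suc n"
      using less.prems by (metis card_0_eq ex_in_conv not0_implies_Suc)
    have "real (card {X \<in> noncrossing_partitions f S. linked f S X u v})
        = catalan (card (cyclic_arc f S u v)) * catalan (n - card (cyclic_arc f S u v))" if v: "v \<in> S" for v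
    proof -
      have sub: "cyclic_arc f S u v \<subseteq> S - {v}" by (rule arc_subset)
      have fin: "finite (cyclic_arc f S u v)" using sub less.prems by (meson finite_Diff finite_subset)
      have "S - cyclic_arc f S u v - {v} = S - {v} - cyclic_arc f S u v" by blast
      then have c: "card (S - cyclic_arc f S u v - {v}) = n - card (cyclic_arc f S u v)"
        using sub fin v n less.prems by (simp add: card_Diff_subset)
      have "real (card (noncrossing_partitions f (cyclic_arc f S u v))) = catalan (card (cyclic_arc f S u v))"
        using less.hyps card_arc_less[OF less.prems(1) v] fin inj_on_subset[OF less.prems(2)] sub
        by blast
      moreover have "real (card (noncrossing_partitions f (S - cyclic_arc f S u v - {v})))
          = catalan (n - card (cyclic_arc f S u v))"
        unfolding c[symmetric]
      proof (rule less.hyps)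
        show "card (S - cyclic_arc f S u v - {v}) < card S" unfolding c n by simp
        show "finite (S - cyclic_arc f S u v - {v})" using less.prems(1) by simp
        show "inj_on f (S - cyclic_arc f S u v - {v})" by (rule inj_on_subset[OF less.prems(2)]) blast
      qed
      ultimately show ?thesis
        unfolding card_linked_split[OF less.prems u v] by simp
    qed
    then have "real (card (noncrossing_partitions f S))
        = (\<Sum>v\<in>S. catalan (card (cyclic_arc f S u v)) * catalan (n - card (cyclic_arc f S u v)))"
      unfolding card_eq_sum_linked[OF less.prems u] by simp
    also have "\<dots> = (\<Sum>k\<in>{..<Suc n}. catalan k * catalan (n - k))"
      using bij_betw_card_arc[OF less.prems u] unfolding n by (rule sum.reindex_bij_betw)
    finally show ?thesis by (simp add: catalan_Suc n lessThan_Suc_atMost)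
  qed
qed

corollary card_linked:
  assumes "finite S" "inj_on f S" "u \<in> S" "v \<in> S"
  shows "real (card {X \<in> noncrossing_partitions f S. linked f S X u v}) =
    catalan (card (cyclic_arc f S u v)) * catalan (card S - 1 - card (cyclic_arc f S u v))"
proof -
  have sub: "cyclic_arc f S u v \<subseteq> S - {v}" by (rule arc_subset)
  have fin: "finite (cyclic_arc f S u v)" using sub assms by (meson finite_Diff finite_subset)
  have "S - cyclic_arc f S u v - {v} = S - {v} - cyclic_arc f S u v" by blast
  then have "card (S - cyclic_arc f S u v - {v}) = card S - 1 - card (cyclic_arc f S u v)"
    using sub fin assms by (simp add: card_Diff_subset)
  moreover have "inj_on f (cyclic_arc f S u v)" "inj_on f (S - cyclic_arc f S u v - {v})"
    using sub by (auto intro: inj_on_subset[OF assms(2)])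
  ultimately show ?thesis
    unfolding card_linked_split[OF assms] using assms fin by (simp add: card_noncrossing_partitions)
qed


subsection \<open>Boundary positions and the length of the output\<close>

fun boundary_pos :: "nat \<Rightarrow> vertex \<Rightarrow> nat" where
  "boundary_pos n (Top i) = i"
| "boundary_pos n (Bot i) = 2 * n + 1 - i"

fun col :: "vertex \<Rightarrow> nat" where
  "col (Top i) = i"
| "col (Bot i) = i"

lemma length_boundary: "length (boundary n) = 2 * n"
  by (simp add: boundary_def)

lemma boundary_nth: "k < 2 * n \<Longrightarrow> boundary n ! k = (if k < n then Top (k + 1) else Bot (2 * n - k))"
  by (auto simp: boundary_def nth_append rev_nth simp del: upt_Suc)

lemma pos_boundary_nth: "k < 2 * n \<Longrightarrow> boundary_pos n (boundary n ! k) = k + 1"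
  by (auto simp: boundary_nth)

lemma set_boundary: "set (boundary n) = verts n"
  by (auto simp: boundary_def verts_def simp del: upt_Suc)

lemma pos_range: "v \<in> verts n \<Longrightarrow> 1 \<le> boundary_pos n v \<and> boundary_pos n v \<le> 2 * n"
  by (auto simp: verts_def)

lemma inj_on_pos: "inj_on (boundary_pos n) (verts n)"
  by (auto simp: verts_def inj_on_def)

lemma finite_verts: "finite (verts n)"
  by (simp add: verts_def)

lemma bij_betw_pos: "bij_betw (boundary_pos n) (verts n) {1..2 * n}"
  unfolding bij_betw_def
proof
  show "boundary_pos n ` verts n = {1..2 * n}"
  proof
    show "{1..2 * n} \<subseteq> boundary_pos n ` verts n"
    proof
      fix p assume p: "p \<in> {1..2 * n}"
      then have "p - 1 < 2 * n" by auto
      then have "boundary_pos n (boundary n ! (p - 1)) = p" "boundary n ! (p - 1) \<in> verts n"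
        using p pos_boundary_nth[of "p - 1" n] nth_mem[of "p - 1" "boundary n"]
        by (auto simp: set_boundary length_boundary)
      then show "p \<in> boundary_pos n ` verts n" by force
    qed
  qed (use pos_range in auto)
qed (rule inj_on_pos)

lemma card_verts: "card (verts n) = 2 * n"
  using bij_betw_same_card[OF bij_betw_pos[of n]] by simp

lemma alternating_boundary_iff:
  assumes "A \<subseteq> verts n" "B \<subseteq> verts n"
  shows "(\<exists>i j k l. i < j \<and> j < k \<and> k < l \<and> l < 2 * n \<and>
            boundary n ! i \<in> A \<and> boundary n ! j \<in> B \<and> boundary n ! k \<in> A \<and> boundary n ! l \<in> B)
    \<longleftrightarrow> (\<exists>a\<in>A. \<exists>b\<in>B. \<exists>c\<in>A. \<exists>d\<in>B. boundary_pos n a < boundary_pos n b \<and> boundary_pos n b < boundary_pos n c \<and> boundary_pos n c < boundary_pos n d)"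
    (is "?L \<longleftrightarrow> ?R")
proof
  assume ?L
  then obtain i j k l where *: "i < j" "j < k" "k < l" "l < 2 * n"
    "boundary n ! i \<in> A" "boundary n ! j \<in> B" "boundary n ! k \<in> A" "boundary n ! l \<in> B"
    by blast
  then have "boundary_pos n (boundary n ! i) = i + 1" "boundary_pos n (boundary n ! j) = j + 1"
    "boundary_pos n (boundary n ! k) = k + 1" "boundary_pos n (boundary n ! l) = l + 1"
    by (auto intro!: pos_boundary_nth[simplified])
  then have "boundary_pos n (boundary n ! i) < boundary_pos n (boundary n ! j)"
    "boundary_pos n (boundary n ! j) < boundary_pos n (boundary n ! k)"
    "boundary_pos n (boundary n ! k) < boundary_pos n (boundary n ! l)"
    using *(1-3) by simp_all
  then show ?R using *(5-8) by blast
next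
  assume ?R
  then obtain a b c d where *: "a \<in> A" "b \<in> B" "c \<in> A" "d \<in> B"
    "boundary_pos n a < boundary_pos n b" "boundary_pos n b < boundary_pos n c" "boundary_pos n c < boundary_pos n d" by blast
  have nth: "boundary n ! (boundary_pos n v - 1) = v \<and> 1 \<le> boundary_pos n v \<and> boundary_pos n v \<le> 2 * n" if "v \<in> verts n" for v
    using that pos_range[OF that] by (cases v) (auto simp: boundary_nth verts_def)
  have "a \<in> verts n" "d \<in> verts n" using *(1,4) assms by auto
  then have "boundary_pos n a - 1 < boundary_pos n b - 1" "boundary_pos n b - 1 < boundary_pos n c - 1" "boundary_pos n c - 1 < boundary_pos n d - 1"
    "boundary_pos n d - 1 < 2 * n"
    using *(5-7) nth[of a] nth[of d] by auto
  moreover have "boundary n ! (boundary_pos n a - 1) \<in> A" "boundary n ! (boundary_pos n b - 1) \<in> B"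
    "boundary n ! (boundary_pos n c - 1) \<in> A" "boundary n ! (boundary_pos n d - 1) \<in> B"
    using * nth assms by (metis subsetD)+
  ultimately show ?L by blast
qed

text \<open>Cutting the circle at its starting point leaves four rotations of the alternation, two
  beginning in \<open>A\<close> and two in \<open>B\<close>.\<close>

lemma crossing_iff_alternating:
  "crossing f A B \<longleftrightarrow>
    (\<exists>a\<in>A. \<exists>b\<in>B. \<exists>c\<in>A. \<exists>d\<in>B. f a < f b \<and> f b < f c \<and> f c < f d) \<or>
    (\<exists>a\<in>B. \<exists>b\<in>A. \<exists>c\<in>B. \<exists>d\<in>A. f a < f b \<and> f b < f c \<and> f c < f d)" (is "_ \<longleftrightarrow> ?R")
proof
  assume "crossing f A B"
  then obtain a b c d where *: "a \<in> A" "b \<in> B" "c \<in> A" "d \<in> B"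
    and "cyc (f a) (f b) (f c)" "cyc (f c) (f d) (f a)"
    unfolding crossing_def by blast
  then consider "f a < f b" "f b < f c" "f c < f d" | "f b < f c" "f c < f d" "f d < f a"
    | "f c < f d" "f d < f a" "f a < f b" | "f d < f a" "f a < f b" "f b < f c"
    unfolding cyc_def by linarith
  then show ?R using * by cases blast+
next
  assume ?R
  then show "crossing f A B"
  proof
    assume "\<exists>a\<in>A. \<exists>b\<in>B. \<exists>c\<in>A. \<exists>d\<in>B. f a < f b \<and> f b < f c \<and> f c < f d"
    then obtain a b c d where *: "a \<in> A" "b \<in> B" "c \<in> A" "d \<in> B"
      "f a < f b" "f b < f c" "f c < f d" by blast
    then have "cyc (f a) (f b) (f c)" "cyc (f c) (f d) (f a)" unfolding cyc_def by linarith+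
    then show ?thesis using *(1-4) unfolding crossing_def by blast
  next
    assume "\<exists>a\<in>B. \<exists>b\<in>A. \<exists>c\<in>B. \<exists>d\<in>A. f a < f b \<and> f b < f c \<and> f c < f d"
    then obtain a b c d where *: "a \<in> B" "b \<in> A" "c \<in> B" "d \<in> A"
      "f a < f b" "f b < f c" "f c < f d" by blast
    then have "cyc (f b) (f c) (f d)" "cyc (f d) (f a) (f b)" unfolding cyc_def by linarith+
    then show ?thesis using *(1-4) unfolding crossing_def by blast
  qed
qed

lemma pPa_eq: "pPa n = noncrossing_partitions (boundary_pos n) (verts n)"
proof -
  have "planar n X \<longleftrightarrow> (\<forall>A\<in>X. \<forall>B\<in>X. A \<noteq> B \<longrightarrow> \<not> crossing (boundary_pos n) A B)"
    if "partition_on (verts n) X" for X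
  proof -
    have sub: "A \<subseteq> verts n" if "A \<in> X" for A
      using that \<open>partition_on (verts n) X\<close> by (auto simp: partition_on_def)
    have "planar n X \<longleftrightarrow> (\<forall>A\<in>X. \<forall>B\<in>X. A \<noteq> B \<longrightarrow>
       \<not> (\<exists>a\<in>A. \<exists>b\<in>B. \<exists>c\<in>A. \<exists>d\<in>B. boundary_pos n a < boundary_pos n b \<and> boundary_pos n b < boundary_pos n c \<and> boundary_pos n c < boundary_pos n d))"
      unfolding planar_def using alternating_boundary_iff[OF sub sub] by simp
    \<comment> \<open>Quantification over ordered pairs of blocks absorbs the disjunct with
      \<open>A\<close> and \<open>B\<close> exchanged.\<close>
    then show ?thesis unfolding crossing_iff_alternating by blast
  qed
  then show ?thesis unfolding pPa_def noncrossing_partitions_def by blast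
qed

section \<open>Output length of the Temperley-Lieb algorithm\<close>

lemma length_run: "length (run_O a b) + length (run_E a b) = b - a"
  unfolding run_O_def run_E_def
  using sum_length_filter_compl[of "\<lambda>i. i mod 2 = a mod 2" "[a..<b]"] by simp

lemma length_pairs:
  "length (concat (map f [(a, b). a \<leftarrow> [1..<Suc m], b \<leftarrow> [1..<Suc m], P a b])) =
    (\<Sum>a=1..m. \<Sum>b=1..m. if P a b then length (f (a, b)) else 0)"
proof -
  have "length (concat (map f [(a, b). a \<leftarrow> xs, b \<leftarrow> ys, P a b])) =
      (\<Sum>a\<leftarrow>xs. \<Sum>b\<leftarrow>ys. if P a b then length (f (a, b)) else 0)" for xs ys
  proof (induction xs)
    case (Cons x xs)
    have "length (concat (map f (concat (map (\<lambda>b. if P x b then [(x, b)] else []) ys)))) =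
      (\<Sum>b\<leftarrow>ys. if P x b then length (f (x, b)) else 0)"
      by (induction ys) auto
    then show ?case using Cons by simp
  qed simp
  then show ?thesis
    by (simp add: interv_sum_list_conv_sum_set_nat atLeastLessThanSuc_atLeastAtMost del: upt_Suc)
qed

lemma length_concat_filtered:
  "length (concat (concat (map (\<lambda>(a, c). if Q a c then [g a c] else []) xs))) =
    length (concat (map (\<lambda>(a, c). if Q a c then g a c else []) xs))"
  by (induction xs) auto

text \<open>Each pair costs its column distance, since the two runs together use every index between
  its columns once. For transversal pairs the truncated differences \<open>b - a\<close> and
  \<open>a - b\<close> are the shares of \<open>top\<close> and \<open>bot\<close>; at most one is
  nonzero.\<close>

lemma length_TL_algorithm:
  "length (TL_algorithm m M) = (\<Sum>a=1..m. \<Sum>b=1..m.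
     (if a < b \<and> {Top a, Top b} \<in> M then b - a else 0) +
     (if a < b \<and> {Bot a, Bot b} \<in> M then b - a else 0) +
     (if {Top a, Bot b} \<in> M then (b - a) + (a - b) else 0))"
proof -
  have len: "length (run_E a b) + length (run_O a b) = b - a" for a b
    using length_run[of a b] by simp
  have if_le: "(if a < b then length (run_E a b) + length (run_O a b) else 0) = b - a" for a b
    by (simp add: len)
  show ?thesis
    unfolding TL_algorithm_def Let_def length_append length_rev length_concat_filtered
      top_pairs_def bottom_pairs_def trans_pairs_def length_pairs prod.case
    by (simp add: len length_run if_le if_distrib[of length] sum.distrib[symmetric] cong: if_cong)
      (auto intro!: sum.cong simp: len)
qed

lemma sum_verts: "(\<Sum>x\<in>verts m. h x) = (\<Sum>a=1..m. h (Top a)) + (\<Sum>a=1..m. h (Bot a))"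
proof -
  have "(\<Sum>x\<in>verts m. h x) = sum h (Top ` {1..m}) + sum h (Bot ` {1..m})"
    unfolding verts_def by (rule sum.union_disjoint) auto
  then show ?thesis by (simp add: sum.reindex inj_on_def)
qed

lemma sum_symmetric_pairs:
  fixes g :: "nat \<Rightarrow> nat \<Rightarrow> real"
  assumes "\<And>a b. g a b = g b a" "\<And>a. g a a = 0"
  shows "(\<Sum>a=1..m. \<Sum>b=1..m. g a b) = 2 * (\<Sum>a=1..m. \<Sum>b=1..m. if a < b then g a b else 0)"
proof -
  have "(\<Sum>a=1..m. \<Sum>b=1..m. g a b)
      = (\<Sum>a=1..m. \<Sum>b=1..m. (if a < b then g a b else 0) + (if b < a then g b a else 0))"
    using assms by (intro sum.cong refl) (auto simp: not_less le_less)
  also have "\<dots> = (\<Sum>a=1..m. \<Sum>b=1..m. if a < b then g a b else 0)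
      + (\<Sum>a=1..m. \<Sum>b=1..m. if b < a then g b a else 0)"
    by (simp only: sum.distrib)
  also have "(\<Sum>a=1..m. \<Sum>b=1..m. if b < a then g b a else 0)
      = (\<Sum>a=1..m. \<Sum>b=1..m. if a < b then g a b else 0)"
    by (rule sum.swap)
  finally show ?thesis by simp
qed

text \<open>A form symmetric in all vertices, ready for the substitution by \<open>rho\<close> and
  \<open>lam\<close>. The factor 2 counts each pair in both orders; the diagonal has distance
  0.\<close>

lemma length_TL_algorithm_eq_sum_pairs:
  "2 * real (length (TL_algorithm m M)) =
    (\<Sum>x\<in>verts m. \<Sum>y\<in>verts m. if {x, y} \<in> M then \<bar>real (col x) - real (col y)\<bar> else 0)"
proof -
  define g where "g x y = (if {x, y} \<in> M then \<bar>real (col x) - real (col y)\<bar> else 0)" for x y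
  have sym: "g x y = g y x" for x y by (simp add: g_def insert_commute abs_minus_commute)
  have "(\<Sum>x\<in>verts m. \<Sum>y\<in>verts m. g x y)
      = (\<Sum>a=1..m. \<Sum>b=1..m. g (Top a) (Top b)) + (\<Sum>a=1..m. \<Sum>b=1..m. g (Top a) (Bot b))
      + ((\<Sum>a=1..m. \<Sum>b=1..m. g (Bot a) (Top b)) + (\<Sum>a=1..m. \<Sum>b=1..m. g (Bot a) (Bot b)))"
    by (simp only: sum_verts sum.distrib)
  also have "(\<Sum>a=1..m. \<Sum>b=1..m. g (Bot a) (Top b)) = (\<Sum>a=1..m. \<Sum>b=1..m. g (Top a) (Bot b))"
    by (subst sum.swap) (simp add: sym)
  also have "(\<Sum>a=1..m. \<Sum>b=1..m. g (Top a) (Top b))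
      = 2 * (\<Sum>a=1..m. \<Sum>b=1..m. if a < b then g (Top a) (Top b) else 0)"
    by (rule sum_symmetric_pairs) (rule sym, simp add: g_def)
  also have "(\<Sum>a=1..m. \<Sum>b=1..m. g (Bot a) (Bot b))
      = 2 * (\<Sum>a=1..m. \<Sum>b=1..m. if a < b then g (Bot a) (Bot b) else 0)"
    by (rule sum_symmetric_pairs) (rule sym, simp add: g_def)
  finally have "(\<Sum>x\<in>verts m. \<Sum>y\<in>verts m. g x y) = 2 * (\<Sum>a=1..m. \<Sum>b=1..m.
      (if a < b then g (Top a) (Top b) else 0) + (if a < b then g (Bot a) (Bot b) else 0)
      + g (Top a) (Bot b))"
    by (simp only: sum.distrib distrib_left)
  also have "(\<Sum>a=1..m. \<Sum>b=1..m.
      (if a < b then g (Top a) (Top b) else 0) + (if a < b then g (Bot a) (Bot b) else 0)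
      + g (Top a) (Bot b)) = real (length (TL_algorithm m M))"
    unfolding length_TL_algorithm of_nat_sum
    by (intro sum.cong refl) (auto simp: g_def of_nat_diff)
  finally show ?thesis unfolding g_def by simp
qed

section \<open>Fattening and cyclic successors\<close>

lemma inj_lam: "inj_on lam (verts n)" and inj_rho: "inj_on rho (verts n)"
  by (auto simp: inj_on_def verts_def)

text \<open>Parity: \<open>rho\<close> gives even columns on top and odd ones at the bottom,
  \<open>lam\<close> the opposite.\<close>

lemma rho_neq_lam: "u \<in> verts n \<Longrightarrow> v \<in> verts n \<Longrightarrow> rho u \<noteq> lam v"
  by (auto simp: verts_def) presburger+

lemma in_verts_iff: "Top k \<in> verts n \<longleftrightarrow> 1 \<le> k \<and> k \<le> n" "Bot k \<in> verts n \<longleftrightarrow> 1 \<le> k \<and> k \<le> n"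
  by (auto simp: verts_def)

lemma verts_double: "verts (2 * n) = rho ` verts n \<union> lam ` verts n"
proof
  show "verts (2 * n) \<subseteq> rho ` verts n \<union> lam ` verts n"
  proof
    fix x assume x: "x \<in> verts (2 * n)"
    show "x \<in> rho ` verts n \<union> lam ` verts n"
    proof (cases x)
      case (Top k)
      then have k: "1 \<le> k" "k \<le> 2 * n" using x by (auto simp: verts_def)
      show ?thesis
      proof (cases "even k")
        case True
        then have "x = rho (Top (k div 2))" "Top (k div 2) \<in> verts n"
          using k Top by (auto simp: verts_def)
        then show ?thesis by blast
      next
        case False
        then have "x = lam (Top ((k + 1) div 2))" "Top ((k + 1) div 2) \<in> verts n"
          using k Top False by (simp_all add: in_verts_iff) presburger+
        then show ?thesis by blast
      qed
    next
      case (Bot k)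
      then have k: "1 \<le> k" "k \<le> 2 * n" using x by (auto simp: verts_def)
      show ?thesis
      proof (cases "even k")
        case True
        then have "x = lam (Bot (k div 2))" "Bot (k div 2) \<in> verts n"
          using k Bot by (auto simp: verts_def)
        then show ?thesis by blast
      next
        case False
        then have "x = rho (Bot ((k + 1) div 2))" "Bot ((k + 1) div 2) \<in> verts n"
          using k Bot False by (simp_all add: in_verts_iff) presburger+
        then show ?thesis by blast
      qed
    qed
  qed
  show "rho ` verts n \<union> lam ` verts n \<subseteq> verts (2 * n)"
  proof -
    have "rho u \<in> verts (2 * n) \<and> lam u \<in> verts (2 * n)" if "u \<in> verts n" for u
      using that by (cases u) (auto simp: in_verts_iff)
    then show ?thesis by blast
  qed
qed

lemma sum_verts_double:
  "(\<Sum>x\<in>verts (2 * n). h x) = (\<Sum>u\<in>verts n. h (rho u)) + (\<Sum>u\<in>verts n. h (lam u))"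
proof -
  have "(\<Sum>x\<in>verts (2 * n). h x) = sum h (rho ` verts n) + sum h (lam ` verts n)"
    unfolding verts_double using rho_neq_lam finite_verts by (intro sum.union_disjoint) auto
  then show ?thesis by (simp add: sum.reindex inj_lam inj_rho)
qed

lemma clockwise_sorted: "sorted_wrt (\<lambda>u v. boundary_pos n u < boundary_pos n v) (clockwise n B)"
  unfolding clockwise_def
  by (intro sorted_wrt_filter) (simp add: sorted_wrt_iff_nth_less length_boundary pos_boundary_nth)

lemma set_clockwise: "B \<subseteq> verts n \<Longrightarrow> set (clockwise n B) = B"
  by (auto simp: clockwise_def set_boundary)

lemma linked_clockwise:
  assumes X: "X \<in> pPa n" and B: "B \<in> X" and j: "j < length (clockwise n B)"
  shows "linked (boundary_pos n) (verts n) X (clockwise n B ! j)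
    (clockwise n B ! (Suc j mod length (clockwise n B)))"
proof -
  define vs m where "vs = clockwise n B" and "m = length vs"
  have set: "set vs = B"
    using set_clockwise X B unfolding vs_def pPa_def partition_on_def by blast
  have less: "boundary_pos n (vs ! i) < boundary_pos n (vs ! k)" if "i < k" "k < m" for i k
    using clockwise_sorted that unfolding vs_def m_def by (auto simp: sorted_wrt_iff_nth_less)
  have j: "j < m" using j by (simp add: m_def vs_def)
  then have "Suc j mod m < m" by (intro mod_less_divisor) linarith
  \<comment> \<open>All other entries come before \<open>j\<close> or after its successor, hence on
    the way from the successor back to \<open>vs ! j\<close>. For the last entry the successor is
    \<open>vs ! 0\<close>, and the others lie between these two.\<close>
  have "cyc (boundary_pos n (vs ! (Suc j mod m))) (boundary_pos n (vs ! i)) (boundary_pos n (vs ! j))"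
    if "i < m" "i \<noteq> j" "i \<noteq> Suc j mod m" for i
  proof (cases "Suc j < m")
    case True
    then have "Suc j mod m = Suc j" by simp
    then show ?thesis
      using less[of i j] less[of j "Suc j"] less[of "Suc j" i] True that
      unfolding cyc_def by (cases "i < j") auto
  next
    case False
    then have "Suc j = m" using j by simp
    then have "Suc j mod m = 0" by simp
    then show ?thesis
      using less[of 0 i] less[of i j] \<open>Suc j = m\<close> that unfolding cyc_def by auto
  qed
  then have "w \<notin> cyclic_arc (boundary_pos n) (verts n) (vs ! j) (vs ! (Suc j mod m))" if "w \<in> B" for w
    using that unfolding cyclic_arc_def set[symmetric] m_def in_set_conv_nth by blast
  then have "B \<inter> cyclic_arc (boundary_pos n) (verts n) (vs ! j) (vs ! (Suc j mod m)) = {}" by blast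
  moreover have "vs ! j \<in> B" "vs ! (Suc j mod m) \<in> B"
    using j \<open>Suc j mod m < m\<close> set nth_mem unfolding m_def by blast+
  ultimately show ?thesis
    using B unfolding linked_def vs_def m_def by blast
qed

lemma fattenE:
  assumes "P \<in> fatten n X"
  obtains B j where "B \<in> X" "j < length (clockwise n B)"
    "P = {rho (clockwise n B ! j), lam (clockwise n B ! (Suc j mod length (clockwise n B)))}"
  using assms unfolding fatten_def Let_def by blast

lemma clockwise_nth_in:
  "j < length (clockwise n B) \<Longrightarrow> clockwise n B ! j \<in> verts n"
  "j < length (clockwise n B) \<Longrightarrow>
    clockwise n B ! (Suc j mod length (clockwise n B)) \<in> verts n"
proof -
  have "set (clockwise n B) \<subseteq> verts n" by (auto simp: clockwise_def set_boundary)
  then show "clockwise n B ! j \<in> verts n" if "j < length (clockwise n B)" for j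
    using that nth_mem by blast
  from this[of "Suc j mod length (clockwise n B)"]
  show "j < length (clockwise n B) \<Longrightarrow>
    clockwise n B ! (Suc j mod length (clockwise n B)) \<in> verts n"
    by (cases "length (clockwise n B)") auto
qed

text \<open>Injectivity and disjoint images of \<open>rho\<close> and \<open>lam\<close> recover
  \<open>u\<close> and \<open>v\<close> from the pair; conversely, uniqueness of the successor makes
  \<open>v\<close> the next entry of the clockwise list.\<close>

lemma rho_lam_in_fatten_iff:
  assumes X: "X \<in> pPa n" and uv: "u \<in> verts n" "v \<in> verts n"
  shows "{rho u, lam v} \<in> fatten n X \<longleftrightarrow> linked (boundary_pos n) (verts n) X u v"
proof
  assume "{rho u, lam v} \<in> fatten n X"
  then obtain B j where B: "B \<in> X" and j: "j < length (clockwise n B)"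
    and eq: "{rho u, lam v} =
      {rho (clockwise n B ! j), lam (clockwise n B ! (Suc j mod length (clockwise n B)))}"
    by (rule fattenE)
  note in_verts = clockwise_nth_in[OF j]
  from eq have "rho u = rho (clockwise n B ! j)"
    "lam v = lam (clockwise n B ! (Suc j mod length (clockwise n B)))"
    using rho_neq_lam[OF uv(1) in_verts(2)] rho_neq_lam[OF in_verts(1) uv(2)]
    by (auto simp: doubleton_eq_iff)
  then have "u = clockwise n B ! j" "v = clockwise n B ! (Suc j mod length (clockwise n B))"
    using inj_onD[OF inj_rho _ uv(1) in_verts(1)] inj_onD[OF inj_lam _ uv(2) in_verts(2)] by blast+
  then show "linked (boundary_pos n) (verts n) X u v" using linked_clockwise[OF X B j] by simp
next
  assume l: "linked (boundary_pos n) (verts n) X u v"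
  then obtain B where B: "B \<in> X" "u \<in> B" unfolding linked_def by blast
  then have "u \<in> set (clockwise n B)"
    using uv(1) by (auto simp: clockwise_def set_boundary)
  then obtain j where j: "j < length (clockwise n B)" "u = clockwise n B ! j"
    by (auto simp: in_set_conv_nth)
  have "v = clockwise n B ! (Suc j mod length (clockwise n B))"
    using linked_unique[OF inj_on_pos _ l] linked_clockwise[OF X B(1) j(1)] X j(2)
    unfolding pPa_def by blast
  then show "{rho u, lam v} \<in> fatten n X"
    using B j unfolding fatten_def Let_def by blast
qed

lemma rho_rho_notin_fatten:
  "u \<in> verts n \<Longrightarrow> v \<in> verts n \<Longrightarrow> {rho u, rho v} \<notin> fatten n X"
  using rho_neq_lam clockwise_nth_in(2) by (metis doubleton_eq_iff fattenE)

lemma lam_lam_notin_fatten: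
  "u \<in> verts n \<Longrightarrow> v \<in> verts n \<Longrightarrow> {lam u, lam v} \<notin> fatten n X"
  using rho_neq_lam clockwise_nth_in(1) by (metis doubleton_eq_iff fattenE)

text \<open>Only mixed pairs of a \<open>rho\<close> and a \<open>lam\<close> vertex occur, and
  their two orders cancel the factor 2.\<close>

lemma pPa_length_eq_sum_linked:
  assumes X: "X \<in> pPa n"
  shows "real (pPa_length n X) = (\<Sum>u\<in>verts n. \<Sum>v\<in>verts n.
    if linked (boundary_pos n) (verts n) X u v then \<bar>real (col (rho u)) - real (col (lam v))\<bar> else 0)"
proof -
  define g where "g x y =
    (if {x, y} \<in> fatten n X then \<bar>real (col x) - real (col y)\<bar> else 0)" for x y
  have "2 * real (pPa_length n X) = (\<Sum>x\<in>verts (2 * n). \<Sum>y\<in>verts (2 * n). g x y)"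
    unfolding pPa_length_def pPa_algorithm_def length_map length_TL_algorithm_eq_sum_pairs g_def ..
  also have "\<dots> = (\<Sum>u\<in>verts n. \<Sum>v\<in>verts n. g (rho u) (rho v))
      + (\<Sum>u\<in>verts n. \<Sum>v\<in>verts n. g (rho u) (lam v))
      + ((\<Sum>u\<in>verts n. \<Sum>v\<in>verts n. g (lam u) (rho v))
      + (\<Sum>u\<in>verts n. \<Sum>v\<in>verts n. g (lam u) (lam v)))"
    by (simp only: sum_verts_double sum.distrib)
  also have "(\<Sum>u\<in>verts n. \<Sum>v\<in>verts n. g (rho u) (rho v)) = 0"
    by (simp add: g_def rho_rho_notin_fatten)
  also have "(\<Sum>u\<in>verts n. \<Sum>v\<in>verts n. g (lam u) (lam v)) = 0"
    by (simp add: g_def lam_lam_notin_fatten)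
  also have "(\<Sum>u\<in>verts n. \<Sum>v\<in>verts n. g (lam u) (rho v))
      = (\<Sum>u\<in>verts n. \<Sum>v\<in>verts n. g (rho u) (lam v))"
    by (subst sum.swap) (simp only: g_def insert_commute[of "lam _"] abs_minus_commute[of "real (col (lam _))"])
  finally have "real (pPa_length n X) = (\<Sum>u\<in>verts n. \<Sum>v\<in>verts n. g (rho u) (lam v))"
    by simp
  also have "\<dots> = (\<Sum>u\<in>verts n. \<Sum>v\<in>verts n.
    if linked (boundary_pos n) (verts n) X u v then \<bar>real (col (rho u)) - real (col (lam v))\<bar> else 0)"
    by (intro sum.cong refl) (simp add: g_def rho_lam_in_fatten_iff[OF X])
  finally show ?thesis .
qed


subsection \<open>Total column distance of chords\<close>

text \<open>The column of the x-th boundary point of a rectangle with \<open>N\<close> columns,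
  rising along the top row and falling along the bottom row.\<close>

definition tent :: "nat \<Rightarrow> nat \<Rightarrow> real" where
  "tent N x = (if x \<le> N then real x else 2 * real N + 1 - real x)"

lemma sum_abs_centered: "(\<Sum>i=1..2 * d + 1. \<bar>2 * real i - 2 * real d - 2\<bar>) = 2 * real d * (real d + 1)"
proof (induction d)
  case (Suc d)
  \<comment> \<open>Shifting the index by one recentres the sum: the range for \<open>d\<close>
    gains one term of size \<open>2 * d + 2\<close> at each end.\<close>
  have "(\<Sum>i=1..2 * Suc d + 1. \<bar>2 * real i - 2 * real (Suc d) - 2\<bar>)
      = (\<Sum>i=0..2 * d + 2. \<bar>2 * real i - 2 * real d - 2\<bar>)"
  proof -
    have "{1..2 * Suc d + 1} = {Suc 0..Suc (2 * d + 2)}" by simp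
    then show ?thesis by (simp only: sum.shift_bounds_cl_Suc_ivl) simp
  qed
  also have "\<dots> = (\<Sum>i=1..2 * d + 1. \<bar>2 * real i - 2 * real d - 2\<bar>)
      + (2 * real d + 2) + (2 * real d + 2)"
    by (simp add: sum.atLeast_Suc_atMost[of 0])
  finally show ?case unfolding Suc.IH by (simp add: algebra_simps)
qed simp

text \<open>Chords of length g = 2 k + 1 inside one row have column distance g, and each row holds N
  - g of them. The g chords around the right end contribute the sum of
  \<open>sum_abs_centered\<close>.\<close>

lemma sum_tent_short:
  assumes "2 * k + 1 \<le> N"
  shows "(\<Sum>x=1..2 * N - 2 * k - 1. \<bar>tent N x - tent N (x + 2 * k + 1)\<bar>) =
    2 * (real N - 2 * real k - 1) * (2 * real k + 1) + 2 * real k * (real k + 1)"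
proof -
  define g where "g = 2 * k + 1"
  define h where "h x = \<bar>tent N x - tent N (x + 2 * k + 1)\<bar>" for x
  have "{1..2 * N - 2 * k - 1} = {1..N - g} \<union> ({N - g + 1..N} \<union> {N + 1..2 * N - g})"
    using assms by (auto simp: g_def)
  moreover have "sum h ({1..N - g} \<union> ({N - g + 1..N} \<union> {N + 1..2 * N - g}))
      = sum h {1..N - g} + sum h ({N - g + 1..N} \<union> {N + 1..2 * N - g})"
    using assms by (intro sum.union_disjoint) (auto simp: g_def)
  moreover have "sum h ({N - g + 1..N} \<union> {N + 1..2 * N - g})
      = sum h {N - g + 1..N} + sum h {N + 1..2 * N - g}"
    by (intro sum.union_disjoint) auto
  ultimately have "(\<Sum>x=1..2 * N - 2 * k - 1. h x)
      = (\<Sum>x=1..N - g. h x) + ((\<Sum>x=N - g + 1..N. h x) + (\<Sum>x=N + 1..2 * N - g. h x))"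
    by simp
  also have "(\<Sum>x=1..N - g. h x) = (\<Sum>x=1..N - g. real g)"
    by (intro sum.cong refl) (auto simp: h_def tent_def g_def)
  also have "(\<Sum>x=N + 1..2 * N - g. h x) = (\<Sum>x=N + 1..2 * N - g. real g)"
    by (intro sum.cong refl) (auto simp: h_def tent_def g_def)
  also have "(\<Sum>x=N - g + 1..N. h x) = (\<Sum>i=1..g. h (i + (N - g)))"
    using sum.shift_bounds_cl_nat_ivl[of h 1 "N - g" g] assms by (simp add: g_def add.commute)
  also have "\<dots> = (\<Sum>i=1..g. \<bar>2 * real i - 2 * real k - 2\<bar>)"
    using assms by (intro sum.cong refl) (auto simp: h_def tent_def g_def of_nat_diff)
  also have "\<dots> = 2 * real k * (real k + 1)" unfolding g_def by (rule sum_abs_centered)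
  finally show ?thesis
    using assms unfolding h_def by (simp add: g_def of_nat_diff algebra_simps)
qed

text \<open>Chords this long all join the top row to the bottom row, so only the centred sum
  remains.\<close>

lemma sum_tent_long:
  assumes "N \<le> 2 * k + 1" "k < N"
  shows "(\<Sum>x=1..2 * N - 2 * k - 1. \<bar>tent N x - tent N (x + 2 * k + 1)\<bar>) =
    2 * real (N - 1 - k) * (real (N - 1 - k) + 1)"
proof -
  define d where "d = N - 1 - k"
  have N: "N = d + k + 1" "2 * N - 2 * k - 1 = 2 * d + 1" using assms by (auto simp: d_def)
  have "(\<Sum>x=1..2 * N - 2 * k - 1. \<bar>tent N x - tent N (x + 2 * k + 1)\<bar>)
      = (\<Sum>x=1..2 * d + 1. \<bar>2 * real x - 2 * real d - 2\<bar>)"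
    unfolding N(2) using assms by (intro sum.cong refl) (auto simp: tent_def N(1))
  also have "\<dots> = 2 * real d * (real d + 1)" by (rule sum_abs_centered)
  finally show ?thesis unfolding d_def .
qed

text \<open>The lengths 2 k + 1 and 2 (N - 1 - k) + 1 add up to 2 N, so one is short and the other
  long. Their sum is one polynomial in \<open>k\<close> for both cases.\<close>

lemma sum_tent_complementary:
  assumes "k < N"
  shows "(\<Sum>x=1..2 * N - 2 * k - 1. \<bar>tent N x - tent N (x + 2 * k + 1)\<bar>) +
      (\<Sum>x=1..2 * N - 2 * (N - 1 - k) - 1. \<bar>tent N x - tent N (x + 2 * (N - 1 - k) + 1)\<bar>)
    = 2 * (real k * (real N - real k) + (real k + 1) * (real N - 1 - real k))"
proof (cases "2 * k + 1 \<le> N")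
  case True
  then have "N \<le> 2 * (N - 1 - k) + 1" "N - 1 - k < N" "N - 1 - (N - 1 - k) = k" using assms by auto
  then show ?thesis
    unfolding sum_tent_short[OF True] using sum_tent_long[of N "N - 1 - k"]
    by (simp add: algebra_simps)
next
  case False
  then have *: "N \<le> 2 * k + 1" "2 * (N - 1 - k) + 1 \<le> N" using assms by auto
  have r: "real (N - 1 - k) = real N - 1 - real k" using assms by (simp add: of_nat_diff)
  show ?thesis
    unfolding sum_tent_long[OF *(1) assms] sum_tent_short[OF *(2)] r
    by (simp add: algebra_simps)
qed

text \<open>The number of strictly intermediate points when going clockwise from \<open>p\<close> to \<open>q\<close> on a circle
  of \<open>N\<close> points; \<open>N - 1\<close> for \<open>p = q\<close>.\<close>

definition gap :: "nat \<Rightarrow> nat \<Rightarrow> nat \<Rightarrow> nat" where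
  "gap N p q = (if p < q then q - p - 1 else N - 1 - (p - q))"

text \<open>Enumerates chords by smaller end point x and length 2 k + 1. Even x is
  \<open>2 * p\<close> with \<open>p < q\<close> and gap k; odd x is \<open>2 * q - 1\<close> with
  \<open>q \<le> p\<close> and gap \<open>N - 1 - k\<close>, where the symmetry of \<open>c\<close>
  enters.\<close>

lemma sum_chords:
  fixes c :: "nat \<Rightarrow> real" and t :: "nat \<Rightarrow> real"
  assumes c: "\<And>k. k < N \<Longrightarrow> c (N - 1 - k) = c k"
  shows "(\<Sum>p=1..N. \<Sum>q=1..N. \<bar>t (2 * p) - t (2 * q - 1)\<bar> * c (gap N p q))
    = (\<Sum>k<N. c k * (\<Sum>x=1..2 * N - 2 * k - 1. \<bar>t x - t (x + 2 * k + 1)\<bar>))"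
proof -
  have "(\<Sum>p=1..N. \<Sum>q=1..N. \<bar>t (2 * p) - t (2 * q - 1)\<bar> * c (gap N p q))
      = (\<Sum>(p, q)\<in>{1..N} \<times> {1..N}. \<bar>t (2 * p) - t (2 * q - 1)\<bar> * c (gap N p q))"
    by (rule sum.cartesian_product)
  also have "\<dots> = (\<Sum>(k, x)\<in>(SIGMA k:{..<N}. {1..2 * N - 2 * k - 1}).
      c k * \<bar>t x - t (x + 2 * k + 1)\<bar>)"
  proof (rule sum.reindex_bij_witness[where
        j = "\<lambda>(p, q). if p < q then (q - p - 1, 2 * p) else (p - q, 2 * q - 1)" and
        i = "\<lambda>(k, x). if even x then (x div 2, x div 2 + k + 1) else ((x + 1) div 2 + k, (x + 1) div 2)"])
    fix a :: "nat \<times> nat" assume a: "a \<in> {1..N} \<times> {1..N}"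
    obtain p q where pq: "a = (p, q)" by (cases a)
    have b: "1 \<le> p" "p \<le> N" "1 \<le> q" "q \<le> N" using a pq by auto
    define j :: "nat \<times> nat \<Rightarrow> nat \<times> nat"
      where "j = (\<lambda>(p, q). if p < q then (q - p - 1, 2 * p) else (p - q, 2 * q - 1))"
    show "(case j a of (k, x) \<Rightarrow> if even x then (x div 2, x div 2 + k + 1) else ((x + 1) div 2 + k, (x + 1) div 2)) = a"
      using b unfolding pq j_def by auto
    show "j a \<in> (SIGMA k:{..<N}. {1..2 * N - 2 * k - 1})"
      using b unfolding pq j_def by auto
    have "c (N - 1 - (p - q)) = c (p - q)" using c[of "p - q"] b by auto
    moreover have "2 * p + 2 * (q - p - 1) + 1 = 2 * q - 1" if "p < q" using that by auto
    moreover have "2 * q - 1 + 2 * (p - q) + 1 = 2 * p" if "\<not> p < q" using that b by auto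
    ultimately show "(case j a of (k, x) \<Rightarrow> c k * \<bar>t x - t (x + 2 * k + 1)\<bar>)
        = (case a of (p, q) \<Rightarrow> \<bar>t (2 * p) - t (2 * q - 1)\<bar> * c (gap N p q))"
      unfolding pq j_def gap_def by (auto simp: abs_minus_commute)
  next
    fix a :: "nat \<times> nat" assume a: "a \<in> (SIGMA k:{..<N}. {1..2 * N - 2 * k - 1})"
    obtain k x where kx: "a = (k, x)" by (cases a)
    have b: "k < N" "1 \<le> x" "x \<le> 2 * N - 2 * k - 1" using a kx by auto
    show "(case case a of (k, x) \<Rightarrow> if even x then (x div 2, x div 2 + k + 1) else ((x + 1) div 2 + k, (x + 1) div 2)
        of (p, q) \<Rightarrow> if p < q then (q - p - 1, 2 * p) else (p - q, 2 * q - 1)) = a"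
      using b unfolding kx by auto
    show "(case a of (k, x) \<Rightarrow> if even x then (x div 2, x div 2 + k + 1) else ((x + 1) div 2 + k, (x + 1) div 2))
       \<in> {1..N} \<times> {1..N}"
      using b unfolding kx by (auto elim!: evenE oddE)
  qed
  also have "\<dots> = (\<Sum>k<N. \<Sum>x=1..2 * N - 2 * k - 1. c k * \<bar>t x - t (x + 2 * k + 1)\<bar>)"
    by (rule sum.Sigma[symmetric]) auto
  finally show ?thesis by (simp add: sum_distrib_left)
qed

lemma sum_tent_catalan:
  assumes "0 < N"
  shows "(\<Sum>p=1..N. \<Sum>q=1..N. \<bar>tent N (2 * p) - tent N (2 * q - 1)\<bar>
        * (catalan (gap N p q) * catalan (N - 1 - gap N p q)))
    = 2 ^ (2 * N - 1) - real ((2 * N) choose N)"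
proof -
  define c where "c k = catalan k * catalan (N - 1 - k)" for k
  define U where "U k = (\<Sum>x=1..2 * N - 2 * k - 1. \<bar>tent N x - tent N (x + 2 * k + 1)\<bar>)" for k
  have c: "c (N - 1 - k) = c k" if "k < N" for k using that by (simp add: c_def)
  \<comment> \<open>Reversing the summation and using the symmetry of \<open>c\<close> replaces
    \<open>U k\<close> by the mean of \<open>U k\<close> and \<open>U (N - 1 - k)\<close>.\<close>
  have "(\<Sum>k<N. c k * U k) = (\<Sum>k<N. c (N - 1 - k) * U (N - 1 - k))"
    using sum.nat_diff_reindex[of "\<lambda>k. c k * U k" N] by simp
  also have "\<dots> = (\<Sum>k<N. c k * U (N - 1 - k))"
    by (intro sum.cong refl) (simp only: c lessThan_iff)
  finally have "(\<Sum>k<N. c k * U k) = (\<Sum>k<N. c k * U (N - 1 - k))" .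
  then have "2 * (\<Sum>k<N. c k * U k) = (\<Sum>k<N. c k * (U k + U (N - 1 - k)))"
    by (simp only: distrib_left sum.distrib mult_2)
  also have "\<dots> = 2 * (\<Sum>k<N. c k *
      (real k * (real N - real k) + (real k + 1) * (real N - 1 - real k)))"
  proof -
    have "U k + U (N - 1 - k)
        = 2 * (real k * (real N - real k) + (real k + 1) * (real N - 1 - real k))" if "k < N" for k
      unfolding U_def using that by (rule sum_tent_complementary)
    then show ?thesis unfolding sum_distrib_left by (intro sum.cong refl) simp
  qed
  finally have "(\<Sum>k<N. c k * U k) = 2 ^ (2 * N - 1) - real ((2 * N) choose N)"
    using sum_catalan_weighted[OF assms] unfolding c_def by simp
  then show ?thesis
    using sum_chords[where c = c and t = "tent N" and N = N, OF c] unfolding c_def U_def by simp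
qed


subsection \<open>Averages\<close>

lemma card_arc_pos:
  assumes uv: "u \<in> verts n" "v \<in> verts n"
  shows "card (cyclic_arc (boundary_pos n) (verts n) u v) = gap (2 * n) (boundary_pos n u) (boundary_pos n v)"
proof -
  define p q where "p = boundary_pos n u" and "q = boundary_pos n v"
  have r: "1 \<le> p" "p \<le> 2 * n" "1 \<le> q" "q \<le> 2 * n"
    using pos_range uv by (auto simp: p_def q_def)
  have eq_iff: "boundary_pos n w = boundary_pos n x \<longleftrightarrow> w = x" if "w \<in> verts n" "x \<in> verts n" for w x
    using inj_on_eq_iff[OF inj_on_pos that] .
  have "boundary_pos n ` cyclic_arc (boundary_pos n) (verts n) u v = {w \<in> boundary_pos n ` verts n. w \<noteq> p \<and> w \<noteq> q \<and> \<not> cyc q w p}"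
    unfolding cyclic_arc_def p_def q_def using eq_iff[OF _ uv(1)] eq_iff[OF _ uv(2)] by auto
  also have "boundary_pos n ` verts n = {1..2 * n}"
    using bij_betw_pos by (rule bij_betw_imp_surj_on)
  \<comment> \<open>For \<open>q \<le> p\<close> the arc passes the starting point, so it is the
    complement of \<open>{q..p}\<close>; \<open>p = q\<close> removes a single point.\<close>
  also have "{w \<in> {1..2 * n}. w \<noteq> p \<and> w \<noteq> q \<and> \<not> cyc q w p} =
      (if p < q then {p<..<q} else {1..2 * n} - {q..p})"
    using r by (auto simp: cyc_def)
  also have "card \<dots> = gap (2 * n) p q"
    using r by (auto simp: gap_def card_Diff_subset)
  finally have "card (boundary_pos n ` cyclic_arc (boundary_pos n) (verts n) u v) = gap (2 * n) p q" .
  moreover have "inj_on (boundary_pos n) (cyclic_arc (boundary_pos n) (verts n) u v)"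
    by (rule inj_on_subset[OF inj_on_pos]) (auto simp: cyclic_arc_def)
  ultimately show ?thesis by (simp add: card_image p_def q_def)
qed

text \<open>On the clockwise tour of the 4 n fattened points, the vertex at position p becomes
  points 2 p - 1 (\<open>lam\<close>) and 2 p (\<open>rho\<close>), in both rows.\<close>

lemma col_rho: "v \<in> verts n \<Longrightarrow> real (col (rho v)) = tent (2 * n) (2 * boundary_pos n v)"
  and col_lam: "v \<in> verts n \<Longrightarrow> real (col (lam v)) = tent (2 * n) (2 * boundary_pos n v - 1)"
  by (auto simp: verts_def tent_def of_nat_diff)

section \<open>Summation over all planar partitions, and closed forms of the averages\<close>

lemma finite_pPa: "finite (pPa n)"
  unfolding pPa_eq by (rule finite_noncrossing_partitions) (rule finite_verts)

lemma card_pPa: "real (card (pPa n)) = real ((4 * n) choose (2 * n)) / (2 * real n + 1)"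
  unfolding pPa_eq card_noncrossing_partitions[OF finite_verts inj_on_pos] card_verts catalan_def
  by simp

text \<open>Exchanging sums, each ordered pair of vertices contributes its distance times the number
  of partitions linking it, which depends only on the gap.\<close>

lemma sum_pPa_length:
  assumes "0 < n"
  shows "(\<Sum>X\<in>pPa n. real (pPa_length n X)) = 2 ^ (4 * n - 1) - real ((4 * n) choose (2 * n))"
proof -
  define D where "D u v = \<bar>real (col (rho u)) - real (col (lam v))\<bar>" for u v
  let ?L = "\<lambda>X u v. linked (boundary_pos n) (verts n) X u v"
  have "(\<Sum>X\<in>pPa n. real (pPa_length n X))
      = (\<Sum>X\<in>pPa n. \<Sum>u\<in>verts n. \<Sum>v\<in>verts n. if ?L X u v then D u v else 0)"
    unfolding D_def by (intro sum.cong refl pPa_length_eq_sum_linked)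
  also have "\<dots> = (\<Sum>u\<in>verts n. \<Sum>v\<in>verts n. \<Sum>X\<in>pPa n. if ?L X u v then D u v else 0)"
    by (subst sum.swap, intro sum.cong refl, rule sum.swap)
  also have "\<dots> = (\<Sum>u\<in>verts n. \<Sum>v\<in>verts n. D u v * real (card {X \<in> pPa n. ?L X u v}))"
    by (intro sum.cong refl) (simp add: sum.If_cases finite_pPa Int_def mult.commute)
  also have "\<dots> = (\<Sum>u\<in>verts n. \<Sum>v\<in>verts n.
      \<bar>tent (2 * n) (2 * boundary_pos n u) - tent (2 * n) (2 * boundary_pos n v - 1)\<bar> *
      (catalan (gap (2 * n) (boundary_pos n u) (boundary_pos n v)) *
       catalan (2 * n - 1 - gap (2 * n) (boundary_pos n u) (boundary_pos n v))))"
    by (intro sum.cong refl)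
      (simp only: D_def col_rho col_lam pPa_eq card_linked[OF finite_verts inj_on_pos]
        card_arc_pos card_verts)
  also have "\<dots> = (\<Sum>u\<in>verts n. \<Sum>q=1..2 * n.
      \<bar>tent (2 * n) (2 * boundary_pos n u) - tent (2 * n) (2 * q - 1)\<bar> *
      (catalan (gap (2 * n) (boundary_pos n u) q) * catalan (2 * n - 1 - gap (2 * n) (boundary_pos n u) q)))"
    by (intro sum.cong refl sum.reindex_bij_betw[OF bij_betw_pos])
  also have "\<dots> = (\<Sum>p=1..2 * n. \<Sum>q=1..2 * n.
      \<bar>tent (2 * n) (2 * p) - tent (2 * n) (2 * q - 1)\<bar> *
      (catalan (gap (2 * n) p q) * catalan (2 * n - 1 - gap (2 * n) p q)))"
    by (rule sum.reindex_bij_betw[OF bij_betw_pos])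
  also have "\<dots> = 2 ^ (2 * (2 * n) - 1) - real ((2 * (2 * n)) choose (2 * n))"
    using assms by (intro sum_tent_catalan) simp
  finally show ?thesis by simp
qed

lemma pPa_nonempty: "pPa n \<noteq> {}"
proof
  assume "pPa n = {}"
  then have "real ((4 * n) choose (2 * n)) / (2 * real n + 1) = 0" using card_pPa[of n] by simp
  then show False by (simp add: add_nonneg_eq_0_iff)
qed

lemma avg_length_pPa_eq:
  assumes "0 < n"
  shows "avg_length_pPa n = (2 * real n + 1) * (2 ^ (4 * n - 1) - real ((4 * n) choose (2 * n)))
    / real ((4 * n) choose (2 * n))"
proof -
  have "avg_length_pPa n = (\<Sum>X\<in>pPa n. real (pPa_length n X)) / real (card (pPa n))"
    unfolding avg_length_pPa_def by (rule integral_pmf_of_set[OF pPa_nonempty finite_pPa])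
  then show ?thesis unfolding sum_pPa_length[OF assms] card_pPa by (simp add: mult.commute)
qed

lemma avg_runtime_pPa_eq_avg_length: "avg_runtime_pPa n = 8 * real n + 2 * avg_length_pPa n"
proof -
  have "avg_runtime_pPa n = (\<Sum>X\<in>pPa n. real (pPa_steps n X)) / real (card (pPa n))"
    unfolding avg_runtime_pPa_def by (rule integral_pmf_of_set[OF pPa_nonempty finite_pPa])
  also have "(\<Sum>X\<in>pPa n. real (pPa_steps n X))
      = 8 * real n * real (card (pPa n)) + 2 * (\<Sum>X\<in>pPa n. real (pPa_length n X))"
    by (simp add: pPa_steps_def sum.distrib sum_distrib_left algebra_simps)
  also have "\<dots> / real (card (pPa n))
      = 8 * real n + 2 * ((\<Sum>X\<in>pPa n. real (pPa_length n X)) / real (card (pPa n)))"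
    using finite_pPa pPa_nonempty by (simp add: add_divide_distrib card_gt_0_iff)
  also have "(\<Sum>X\<in>pPa n. real (pPa_length n X)) / real (card (pPa n)) = avg_length_pPa n"
    unfolding avg_length_pPa_def by (rule integral_pmf_of_set[OF pPa_nonempty finite_pPa, symmetric])
  finally show ?thesis .
qed

lemma avg_runtime_pPa_eq:
  assumes "0 < n"
  shows "avg_runtime_pPa n =
    4 * real n + 2 ^ (4 * n) * (2 * real n + 1) / real ((4 * n) choose (2 * n)) - 2"
proof -
  define b where "b = real ((4 * n) choose (2 * n))"
  have "b \<noteq> 0" by (simp add: b_def)
  have "(2::real) ^ (4 * n) = 2 * 2 ^ (4 * n - 1)" 
    using assms power_Suc[of "2::real" "4 * n - 1"] by simp
  then show ?thesis
    unfolding avg_runtime_pPa_eq_avg_length avg_length_pPa_eq[OF assms] b_def[symmetric]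
    using \<open>b \<noteq> 0\<close> by (simp add: field_simps)
qed

section \<open>Asymptotics of the average runtime\<close>

lemma avg_runtime_pPa_asymp_equiv:
  "avg_runtime_pPa \<sim>[at_top] (\<lambda>n. 2 * sqrt (2 * pi) * real n powr (3 / 2))"
proof -
  have fl: "filterlim (\<lambda>n::nat. 2 * n) at_top at_top" by real_asymp
  have "(\<lambda>n. real ((4 * n) choose (2 * n))) \<sim>[at_top] (\<lambda>n. 2 ^ (4 * n) / sqrt (2 * pi * real n))"
  proof -
    have "(4::real) ^ (2 * n) = 2 ^ (4 * n)" for n by (simp add: power_mult)
    then show ?thesis
      using asymp_equiv_compose'[OF central_binomial_asymp_equiv fl] by (simp add: mult_ac)
  qed
  then have "(\<lambda>n. 2 ^ (4 * n) * (2 * real n + 1) / real ((4 * n) choose (2 * n))) \<sim>[at_top]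
      (\<lambda>n. 2 ^ (4 * n) * (2 * real n + 1) / (2 ^ (4 * n) / sqrt (2 * pi * real n)))"
    by (intro asymp_equiv_divide asymp_equiv_refl)
  also have "\<dots> = (\<lambda>n. sqrt (2 * pi) * ((2 * real n + 1) * sqrt (real n)))"
    by (auto simp: real_sqrt_mult)
  also have "\<dots> \<sim>[at_top] (\<lambda>n. sqrt (2 * pi) * (2 * real n powr (3 / 2)))"
  proof (rule asymp_equiv_mult[OF asymp_equiv_refl])
    show "(\<lambda>n. (2 * real n + 1) * sqrt (real n)) \<sim>[at_top] (\<lambda>n. 2 * real n powr (3 / 2))"
      by real_asymp
  qed
  also have "\<dots> = (\<lambda>n. 2 * sqrt (2 * pi) * real n powr (3 / 2))" by (simp add: mult_ac)
  finally have main: "(\<lambda>n. 2 ^ (4 * n) * (2 * real n + 1) / real ((4 * n) choose (2 * n)))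
      \<sim>[at_top] (\<lambda>n. 2 * sqrt (2 * pi) * real n powr (3 / 2))" .
  \<comment> \<open>The quotient with the central binomial already has order n^(3/2), so the linear
    remainder is negligible.\<close>
  have "(\<lambda>n. 4 * real n - 2) \<in> o(\<lambda>n. 2 * sqrt (2 * pi) * real n powr (3 / 2))"
    by real_asymp
  from iffD2[OF asymp_equiv_add_right[OF this] main]
  have "(\<lambda>n. 2 ^ (4 * n) * (2 * real n + 1) / real ((4 * n) choose (2 * n)) + (4 * real n - 2))
      \<sim>[at_top] (\<lambda>n. 2 * sqrt (2 * pi) * real n powr (3 / 2))" .
  moreover have "eventually (\<lambda>n. 2 ^ (4 * n) * (2 * real n + 1) / real ((4 * n) choose (2 * n))
      + (4 * real n - 2) = avg_runtime_pPa n) at_top"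
    using eventually_gt_at_top[of 0] by eventually_elim (simp add: avg_runtime_pPa_eq)
  ultimately show ?thesis
    by (rule asymp_equiv_transfer) simp
qed

theorem proposition3p4p5:
  shows "(\<forall>n::nat. 2 \<le> n \<longrightarrow>
            avg_length_pPa n =
              (2 * real n + 1) * (2 ^ (4 * n - 1) - real ((4 * n) choose (2 * n)))
                / real ((4 * n) choose (2 * n)) \<and>
            avg_runtime_pPa n =
              4 * real n + 2 ^ (4 * n) * (2 * real n + 1) / real ((4 * n) choose (2 * n)) - 2)
         \<and> avg_runtime_pPa \<sim>[at_top] (\<lambda>n. 2 * sqrt (2 * pi) * real n powr (3 / 2))"
  using avg_length_pPa_eq avg_runtime_pPa_eq avg_runtime_pPa_asymp_equiv by simp

end
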